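(* Let $Q$ be a cluster quiver of mutation-Dynkin type with connected components $Q_1,\dots,Q_r$ of mutation-Dynkin types $A_{n_1},\dots,A_{n_r}$ respectively, for some $n_1,\dots,n_r\in\mathbb{Z}^+$. Let $G_Q$ be the cluster group of $Q$ with its set of defining generators $T$. For any $I\subset T$, let $Q_I$ be the full subquiver of $Q$ on the vertices corresponding to the elements of $I$, let $G_{Q_I}$ be the cluster group of $Q_I$, with its defining generators denoted $t_i'$ (one for each $t_i\in I$), and let $G_I$ be the subgroup of $G_Q$ generated by $I$. Then there exists an isomorphism $$G_{Q_I}\longrightarrow G_I,\qquad t_i'\longmapsto t_i .$$
   Context: A cluster quiver is a finite quiver (directed multigraph) with no loops and no oriented 2-cycles; its set of vertices is denoted $Q_0$. The mutation $\mu_v(Q)$ of a cluster quiver $Q$ at a vertex $v$ is obtained by: (a) for each path $u\to v\to w$ adding an arrow $u\to w$ (counted with multiplicity: $x$ arrows $u\to v$ and $y$ arrows $v\to w$ give $xy$ new arrows); (b) reversing each arrow incident to $v$; (c) repeatedly deleting pairs of arrows forming 2-cycles until none remain. Two cluster quivers are mutation-equivalent if a finite sequence of mutations transforms one into the other. A cluster quiver is of mutation-Dynkin type $A_n$ if it is mutation-equivalent to an orientation of the Dynkin diagram $A_n$ (a path on $n$ vertices). An arrow of $Q$ joining $i$ and $j$ is simple if it is the only arrow between $i$ and $j$. The cluster group $G_Q$ of a cluster quiver $Q$ is the group with presentation $\langle T\mid R\rangle$, where $T=\{t_i : i\in Q_0\}$ and $R$ consists of: (a) $t_i^2=e$ for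 all $i\in Q_0$; (b)(i) $t_it_j=t_jt_i$ if there is no arrow between $i$ and $j$; (b)(ii) $t_it_jt_i=t_jt_it_j$ if $i$ and $j$ are joined by a simple arrow; (c) for every chordless oriented cycle $i_1\to i_2\to\cdots\to i_m\to i_1$ in $Q$ all of whose arrows are simple, the relations stating that the $m$ words $t_{i_a}t_{i_{a+1}}\cdots t_{i_{a+2m-3}}$ ($a=1,\dots,m$, subscripts of $i$ taken modulo $m$), each of length $2m-2$, are all equal. *)

theory Defs
  imports "HOL-Algebra.Algebra"
begin

section \<open>Groups given by generators and relations\<close>

text \<open>
  The letter \<open>(x, True)\<close> stands for the generator \<open>x\<close> and \<open>(x, False)\<close> for its formal inverse.
  A relation \<open>u = v\<close> is a pair of words.
\<close>

type_synonym 'a gword = "('a \<times> bool) list"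

definition gwords :: "'a set \<Rightarrow> 'a gword set" where
  "gwords S = lists (S \<times> UNIV)"

inductive_set pres_cong :: "'a set \<Rightarrow> ('a gword \<times> 'a gword) set \<Rightarrow> ('a gword \<times> 'a gword) set"
  for S R where
  refl: "w \<in> gwords S \<Longrightarrow> (w, w) \<in> pres_cong S R"
| sym: "(u, v) \<in> pres_cong S R \<Longrightarrow> (v, u) \<in> pres_cong S R"
| trans: "(u, v) \<in> pres_cong S R \<Longrightarrow> (v, w) \<in> pres_cong S R \<Longrightarrow> (u, w) \<in> pres_cong S R"
| cancel: "u \<in> gwords S \<Longrightarrow> v \<in> gwords S \<Longrightarrow> x \<in> S \<Longrightarrow>
    (u @ [(x, b), (x, \<not> b)] @ v, u @ v) \<in> pres_cong S R"
| rel: "u \<in> gwords S \<Longrightarrow> v \<in> gwords S \<Longrightarrow> (r, s) \<in> R \<Longrightarrow> r \<in> gwords S \<Longrightarrow> s \<in> gwords S \<Longrightarrow>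
    (u @ r @ v, u @ s @ v) \<in> pres_cong S R"

definition presented_group ::
  "'a set \<Rightarrow> ('a gword \<times> 'a gword) set \<Rightarrow> 'a gword set monoid" where
  "presented_group S R =
    \<lparr>carrier = gwords S // pres_cong S R,
     monoid.mult = (\<lambda>A B. \<Union>u\<in>A. \<Union>v\<in>B. pres_cong S R `` {u @ v}),
     one = pres_cong S R `` {[]}\<rparr>"

definition pres_gen :: "'a set \<Rightarrow> ('a gword \<times> 'a gword) set \<Rightarrow> 'a \<Rightarrow> 'a gword set" where
  "pres_gen S R x = pres_cong S R `` {[(x, True)]}"

lemma gwords_append [simp]: "u @ v \<in> gwords S \<longleftrightarrow> u \<in> gwords S \<and> v \<in> gwords S"
  by (auto simp: gwords_def)

lemma gwords_Nil [simp]: "[] \<in> gwords S"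
  by (simp add: gwords_def)

lemma gwords_Cons [simp]: "(x, b) # w \<in> gwords S \<longleftrightarrow> x \<in> S \<and> w \<in> gwords S"
  by (auto simp: gwords_def)

lemma pres_cong_gwords:
  assumes "(u, v) \<in> pres_cong S R"
  shows "u \<in> gwords S \<and> v \<in> gwords S"
  using assms by induction auto

lemma equiv_pres_cong: "equiv (gwords S) (pres_cong S R)"
proof (rule equivI)
  show "pres_cong S R \<subseteq> gwords S \<times> gwords S"
    by (auto dest: pres_cong_gwords)
  show "refl_on (gwords S) (pres_cong S R)"
    by (simp add: refl_on_def pres_cong.refl)
  show "Relation.sym (pres_cong S R)"
    by (rule symI) (rule pres_cong.sym)
  show "Relation.trans (pres_cong S R)"
    by (rule transI) (rule pres_cong.trans)
qed

lemma pres_cong_context: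
  assumes "(u, v) \<in> pres_cong S R" "p \<in> gwords S" "q \<in> gwords S"
  shows "(p @ u @ q, p @ v @ q) \<in> pres_cong S R"
  using assms
proof (induction rule: pres_cong.induct)
  case (refl w)
  then show ?case by (simp add: pres_cong.refl)
next
  case (sym u v)
  then show ?case by (blast intro: pres_cong.sym)
next
  case (trans u v w)
  then show ?case by (blast intro: pres_cong.trans)
next
  case (cancel u v x b)
  then show ?case
    using pres_cong.cancel[of "p @ u" S "v @ q" x b R] by simp
next
  case (rel u v r s)
  then show ?case
    using pres_cong.rel[of "p @ u" S "v @ q" r s R] by simp
qed

lemma pres_cong_append:
  assumes "(u, u') \<in> pres_cong S R" "(v, v') \<in> pres_cong S R"
  shows "(u @ v, u' @ v') \<in> pres_cong S R"
proof (rule pres_cong.trans)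
  show "(u @ v, u' @ v) \<in> pres_cong S R"
    using pres_cong_context[OF assms(1), of "[]" v] pres_cong_gwords[OF assms(2)] by simp
  show "(u' @ v, u' @ v') \<in> pres_cong S R"
    using pres_cong_context[OF assms(2), of u' "[]"] pres_cong_gwords[OF assms(1)] by simp
qed

lemma presented_group_mult:
  assumes "u \<in> gwords S" "v \<in> gwords S"
  shows "pres_cong S R `` {u} \<otimes>\<^bsub>presented_group S R\<^esub> pres_cong S R `` {v}
    = pres_cong S R `` {u @ v}"
proof -
  have "pres_cong S R `` {u' @ v'} = pres_cong S R `` {u @ v}"
    if "(u, u') \<in> pres_cong S R" "(v, v') \<in> pres_cong S R" for u' v'
    using equiv_class_eq[OF equiv_pres_cong pres_cong_append[OF that]] by simp
  moreover have "(u, u) \<in> pres_cong S R" "(v, v) \<in> pres_cong S R"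
    using assms by (auto intro: pres_cong.refl)
  ultimately have "(\<Union>u'\<in>pres_cong S R `` {u}. \<Union>v'\<in>pres_cong S R `` {v}.
      pres_cong S R `` {u' @ v'}) = pres_cong S R `` {u @ v}"
    by (intro equalityI subsetI) (blast, blast)
  then show ?thesis
    by (simp add: presented_group_def)
qed

definition gword_inv :: "'a gword \<Rightarrow> 'a gword" where
  "gword_inv w = rev (map (\<lambda>(x, b). (x, \<not> b)) w)"

lemma gword_inv_gwords: "w \<in> gwords S \<Longrightarrow> gword_inv w \<in> gwords S"
  by (auto simp: gwords_def gword_inv_def)

lemma gword_inv_left: "w \<in> gwords S \<Longrightarrow> (gword_inv w @ w, []) \<in> pres_cong S R"
proof (induction w)
  case Nil
  then show ?case by (simp add: gword_inv_def pres_cong.refl)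
next
  case (Cons a w)
  obtain x b where a: "a = (x, b)" by (cases a)
  have "(gword_inv w @ [(x, \<not> b), (x, \<not> \<not> b)] @ w, gword_inv w @ w) \<in> pres_cong S R"
    using Cons.prems a by (intro pres_cong.cancel) (auto intro: gword_inv_gwords)
  moreover have "(gword_inv w @ w, []) \<in> pres_cong S R"
    using Cons a by simp
  ultimately have "(gword_inv w @ [(x, \<not> b), (x, \<not> \<not> b)] @ w, []) \<in> pres_cong S R"
    by (rule pres_cong.trans)
  then show ?case
    by (simp add: gword_inv_def a)
qed

lemma group_presented_group: "group (presented_group S R)"
proof (rule groupI)
  let ?G = "presented_group S R" and ?c = "\<lambda>w. pres_cong S R `` {w}"
  have carrier: "A \<in> carrier ?G \<longleftrightarrow> (\<exists>w\<in>gwords S. A = ?c w)" for A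
    by (auto simp: presented_group_def quotient_def)
  have one: "\<one>\<^bsub>?G\<^esub> = ?c []"
    by (simp add: presented_group_def)
  fix x y z
  assume "x \<in> carrier ?G"
  then obtain u where u: "u \<in> gwords S" "x = ?c u"
    using carrier by blast
  show "\<one>\<^bsub>?G\<^esub> \<otimes>\<^bsub>?G\<^esub> x = x"
    using u by (simp add: one presented_group_mult)
  have "?c (gword_inv u) \<otimes>\<^bsub>?G\<^esub> x = \<one>\<^bsub>?G\<^esub>"
    using u equiv_class_eq[OF equiv_pres_cong gword_inv_left[OF u(1)]]
    by (simp add: one presented_group_mult gword_inv_gwords)
  then show "\<exists>y\<in>carrier ?G. y \<otimes>\<^bsub>?G\<^esub> x = \<one>\<^bsub>?G\<^esub>"
    using gword_inv_gwords[OF u(1)] carrier by blast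
  assume "y \<in> carrier ?G"
  then obtain v where v: "v \<in> gwords S" "y = ?c v"
    using carrier by blast
  show "x \<otimes>\<^bsub>?G\<^esub> y \<in> carrier ?G"
    using u v carrier by (auto simp: presented_group_mult)
  assume "z \<in> carrier ?G"
  then obtain w where "w \<in> gwords S" "z = ?c w"
    using carrier by blast
  with u v show "x \<otimes>\<^bsub>?G\<^esub> y \<otimes>\<^bsub>?G\<^esub> z = x \<otimes>\<^bsub>?G\<^esub> (y \<otimes>\<^bsub>?G\<^esub> z)"
    by (simp add: presented_group_mult)
next
  show "\<one>\<^bsub>presented_group S R\<^esub> \<in> carrier (presented_group S R)"
    by (auto simp: presented_group_def quotient_def)
qed


section \<open>Cluster quivers and mutation\<close>

text \<open>
  Arrows have no individual identity here: \<open>arr Q i j\<close> is the number of arrows from \<open>i\<close> to \<open>j\<close>.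
\<close>

record 'a quiver =
  verts :: "'a set"
  arr :: "'a \<Rightarrow> 'a \<Rightarrow> nat"

definition arrows_between :: "'a quiver \<Rightarrow> 'a \<Rightarrow> 'a \<Rightarrow> nat" where
  "arrows_between Q i j = arr Q i j + arr Q j i"

definition cluster_quiver :: "'a quiver \<Rightarrow> bool" where
  "cluster_quiver Q \<longleftrightarrow>
    finite (verts Q) \<and>
    (\<forall>i j. arr Q i j > 0 \<longrightarrow> i \<in> verts Q \<and> j \<in> verts Q) \<and>
    (\<forall>i. arr Q i i = 0) \<and>
    (\<forall>i j. \<not> (arr Q i j > 0 \<and> arr Q j i > 0))"

definition full_subquiver :: "'a quiver \<Rightarrow> 'a set \<Rightarrow> 'a quiver" where
  "full_subquiver Q I = \<lparr>verts = I, arr = (\<lambda>i j. if i \<in> I \<and> j \<in> I then arr Q i j else 0)\<rparr>"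

definition add_paths :: "'a \<Rightarrow> 'a quiver \<Rightarrow> 'a quiver" where
  "add_paths v Q = \<lparr>verts = verts Q, arr = (\<lambda>i j. arr Q i j + arr Q i v * arr Q v j)\<rparr>"

definition reverse_at :: "'a \<Rightarrow> 'a quiver \<Rightarrow> 'a quiver" where
  "reverse_at v Q =
    \<lparr>verts = verts Q, arr = (\<lambda>i j. if i = v \<or> j = v then arr Q j i else arr Q i j)\<rparr>"

text \<open>
  Deleting 2-cycles until none remain leaves \<open>a - min a b\<close> arrows from \<open>i\<close> to \<open>j\<close>, where \<open>a\<close> and \<open>b\<close>
  count the arrows from \<open>i\<close> to \<open>j\<close> and from \<open>j\<close> to \<open>i\<close>; this is the truncated difference \<open>a - b\<close>.
\<close>

definition delete_2cycles :: "'a quiver \<Rightarrow> 'a quiver" where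
  "delete_2cycles Q = \<lparr>verts = verts Q, arr = (\<lambda>i j. arr Q i j - arr Q j i)\<rparr>"

definition mutate :: "'a \<Rightarrow> 'a quiver \<Rightarrow> 'a quiver" where
  "mutate v Q = delete_2cycles (reverse_at v (add_paths v Q))"

definition mutation_equivalent :: "'a quiver \<Rightarrow> 'a quiver \<Rightarrow> bool" where
  "mutation_equivalent = (\<lambda>P P'. \<exists>v\<in>verts P. P' = mutate v P)\<^sup>*\<^sup>*"

definition dynkin_A_orientation :: "nat \<Rightarrow> 'a quiver \<Rightarrow> bool" where
  "dynkin_A_orientation n Q \<longleftrightarrow>
    cluster_quiver Q \<and>
    (\<exists>f. bij_betw f {1..n} (verts Q) \<and>
      (\<forall>i\<in>{1..n}. \<forall>j\<in>{1..n}.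
        arrows_between Q (f i) (f j) = (if j = Suc i \<or> i = Suc j then 1 else 0)))"

definition mutation_dynkin_A :: "nat \<Rightarrow> 'a quiver \<Rightarrow> bool" where
  "mutation_dynkin_A n Q \<longleftrightarrow>
    cluster_quiver Q \<and> (\<exists>Q'. mutation_equivalent Q Q' \<and> dynkin_A_orientation n Q')"

text \<open>For a cluster quiver, paths of arrows starting in \<open>verts Q\<close> stay in \<open>verts Q\<close>.\<close>

definition connected_in :: "'a quiver \<Rightarrow> 'a \<Rightarrow> 'a \<Rightarrow> bool" where
  "connected_in Q = (\<lambda>i j. arrows_between Q i j > 0)\<^sup>*\<^sup>*"

definition connected_components :: "'a quiver \<Rightarrow> 'a quiver set" where
  "connected_components Q =
    (\<lambda>i. full_subquiver Q {j \<in> verts Q. connected_in Q i j}) ` verts Q"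


section \<open>Cluster groups\<close>

definition simple_arrow :: "'a quiver \<Rightarrow> 'a \<Rightarrow> 'a \<Rightarrow> bool" where
  "simple_arrow Q i j \<longleftrightarrow> arr Q i j > 0 \<and> arrows_between Q i j = 1"

text \<open>The cycle \<open>c ! 0 \<rightarrow> c ! 1 \<rightarrow> \<dots> \<rightarrow> c ! (m - 1) \<rightarrow> c ! 0\<close>, where \<open>m = length c\<close>.\<close>

definition chordless_simple_cycle :: "'a quiver \<Rightarrow> 'a list \<Rightarrow> bool" where
  "chordless_simple_cycle Q c \<longleftrightarrow>
    (let m = length c in
      3 \<le> m \<and> distinct c \<and> set c \<subseteq> verts Q \<and>
      (\<forall>a<m. simple_arrow Q (c ! a) (c ! (Suc a mod m))) \<and>
      (\<forall>a<m. \<forall>b<m. b \<noteq> Suc a mod m \<and> a \<noteq> Suc b mod m \<longrightarrow>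
        arrows_between Q (c ! a) (c ! b) = 0))"

definition cycle_word :: "'a list \<Rightarrow> nat \<Rightarrow> 'a list" where
  "cycle_word c a = map (\<lambda>k. c ! ((a + k) mod length c)) [0..<2 * length c - 2]"

definition pos_word :: "'a list \<Rightarrow> 'a gword" where
  "pos_word = map (\<lambda>i. (i, True))"

definition cluster_relations :: "'a quiver \<Rightarrow> ('a gword \<times> 'a gword) set" where
  "cluster_relations Q =
     {(pos_word [i, i], []) |i. i \<in> verts Q}
   \<union> {(pos_word [i, j], pos_word [j, i]) |i j.
        i \<in> verts Q \<and> j \<in> verts Q \<and> arrows_between Q i j = 0}
   \<union> {(pos_word [i, j, i], pos_word [j, i, j]) |i j.
        i \<in> verts Q \<and> j \<in> verts Q \<and> (simple_arrow Q i j \<or> simple_arrow Q j i)}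
   \<union> {(pos_word (cycle_word c a), pos_word (cycle_word c b)) |c a b.
        chordless_simple_cycle Q c \<and> a < length c \<and> b < length c}"

definition cluster_group :: "'a quiver \<Rightarrow> 'a gword set monoid" where
  "cluster_group Q = presented_group (verts Q) (cluster_relations Q)"

definition cluster_gen :: "'a quiver \<Rightarrow> 'a \<Rightarrow> 'a gword set" where
  "cluster_gen Q = pres_gen (verts Q) (cluster_relations Q)"

lemma group_cluster_group: "group (cluster_group Q)"
  by (simp add: cluster_group_def group_presented_group)

end

theory Submission
  imports Defs
begin

text \<open>
  Words in the generators are detected by permutations, and the detecting permutations of a full
  subquiver are those of the whole quiver.

  A quiver whose components are of mutation type \<open>A\<close> is the line graph of a forest with oriented
  corners: its vertices are the edges of a forest, two of them are joined by an arrow (which is then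
  simple) iff the edges share a point, and any three edges at a common point form an oriented 3-cycle.
  This is the locale \<open>forest_model\<close>. An orientation of the Dynkin diagram \<open>A\<^sub>n\<close> is the line graph of
  a path. A mutation at an edge \<open>v\<close> with ends \<open>p, q\<close> slides along \<open>v\<close> every edge \<open>i\<close> with an arrow
  \<open>v \<rightarrow> i\<close>, from \<open>p\<close> to \<open>q\<close> or back (\<open>forest_model_mutate\<close>). Mutation being an involution, all of
  the mutation class is covered, and the models of the components are put side by side
  (\<open>forest_model_glue\<close>).

  Send \<open>t\<^sub>i\<close> to the transposition of the two ends of the edge \<open>i\<close>. Then two words are equal in the
  cluster group iff their permutations are equal (\<open>pres_cong_iff_word_perm_eq\<close>). The transpositions
  satisfy the cycle relations because a chordless cycle in the line graph of a forest is a triangle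
  whose edges share a point (\<open>perm_pres_cong\<close>). Conversely, let \<open>w\<close> be a word over a set \<open>W\<close> of edges with trivial permutation,
  and let \<open>l\<close> be a leaf of the forest \<open>W\<close>, on the edge \<open>e\<close>. The relations rewrite \<open>w\<close> as \<open>x h\<close>,
  where \<open>x\<close> spells a path of the forest from \<open>l\<close> to the image of \<open>l\<close>, and \<open>h\<close> avoids \<open>e\<close>
  (\<open>coset_decomposition\<close>). As \<open>w\<close> fixes \<open>l\<close>, the path is empty, so that induction on \<open>W\<close> applies to
  \<open>h\<close> (\<open>perm_id_imp_trivial\<close>).

  Deleting edges of a forest leaves a forest, so a model of \<open>Q\<close> restricts to a model of the full
  subquiver on \<open>I\<close> with the same transpositions. Hence words over \<open>I\<close> are equal in the cluster group
  of the subquiver iff they are equal in that of \<open>Q\<close>; this says that \<open>t'\<^sub>i \<mapsto> t\<^sub>i\<close> is well defined and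
  injective (\<open>subpresentation_iso\<close>).
\<close>

section \<open>Quivers as line graphs of forests\<close>

definition ends :: "('a \<Rightarrow> 'p) \<Rightarrow> ('a \<Rightarrow> 'p) \<Rightarrow> 'a \<Rightarrow> 'p set" where
  "ends s t i = {s i, t i}"

lemma image_Un_eq_Union_ends: "s ` G \<union> t ` G = (\<Union>i\<in>G. ends s t i)"
  by (auto simp: ends_def)

text \<open>
  Edge \<open>i\<close> joins the points \<open>s i\<close> and \<open>t i\<close>. The forest condition says that every nonempty set of edges
  touches more points than it has edges; this form excludes loops and multiple edges as well, passes
  to subsets at once, and survives the sliding of edges by a short count. The last assumption makes
  every triple of edges at a point an oriented 3-cycle; as a tournament on four vertices cannot have
  all its triples cyclic, it also bounds the degrees of the forest by 3.
\<close>

locale forest_model =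
  fixes Q :: "'a quiver" and s t :: "'a \<Rightarrow> 'p"
  assumes cluster: "cluster_quiver Q"
    and forest: "F \<subseteq> verts Q \<Longrightarrow> F \<noteq> {} \<Longrightarrow> card F < card (s ` F \<union> t ` F)"
    and arrows: "i \<in> verts Q \<Longrightarrow> j \<in> verts Q \<Longrightarrow> i \<noteq> j \<Longrightarrow>
      arrows_between Q i j = (if ends s t i \<inter> ends s t j = {} then 0 else 1)"
    and cyclic: "{i, j, k} \<subseteq> verts Q \<Longrightarrow> distinct [i, j, k] \<Longrightarrow>
      x \<in> ends s t i \<inter> ends s t j \<inter> ends s t k \<Longrightarrow> 0 < arr Q i j \<Longrightarrow> 0 < arr Q j k"
begin

lemma finite_verts: "finite (verts Q)"
  using cluster by (simp add: cluster_quiver_def)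

lemma not_loop: "s i \<noteq> t i" if "i \<in> verts Q"
  using forest[of "{i}"] that by auto

lemma ends_eqI:
  assumes "i \<in> verts Q" "x \<in> ends s t i" "y \<in> ends s t i" "x \<noteq> y"
  shows "ends s t i = {x, y}"
  using assms unfolding ends_def by blast

lemma at_most_one_common_end:
  assumes V: "i \<in> verts Q" "j \<in> verts Q" "i \<noteq> j"
    and "x \<in> ends s t i \<inter> ends s t j" "y \<in> ends s t i \<inter> ends s t j"
  shows "x = y"
proof (rule ccontr)
  assume "x \<noteq> y"
  then have "ends s t i = {x, y}" "ends s t j = {x, y}"
    using assms ends_eqI[of i x y] ends_eqI[of j x y] by simp_all
  then have "s ` {i, j} \<union> t ` {i, j} = {x, y}"
    by (auto simp: ends_def)
  then show False
    using forest[of "{i, j}"] V \<open>x \<noteq> y\<close> by simp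
qed

lemma no_triangle:
  assumes V: "i \<in> verts Q" "j \<in> verts Q" "k \<in> verts Q" "distinct [i, j, k]"
    and xyz: "x \<in> ends s t i \<inter> ends s t j" "y \<in> ends s t j \<inter> ends s t k" "z \<in> ends s t i \<inter> ends s t k"
  shows "x = y"
proof (rule ccontr)
  assume xy: "x \<noteq> y"
  have "z \<noteq> x" using xy at_most_one_common_end[of j k x y] V xyz by auto
  moreover have "z \<noteq> y" using xy at_most_one_common_end[of i j x y] V xyz by auto
  ultimately have "ends s t i = {x, z}" "ends s t j = {x, y}" "ends s t k = {y, z}"
    using xy V xyz ends_eqI[of i x z] ends_eqI[of j x y] ends_eqI[of k y z] by simp_all
  then have "s ` {i, j, k} \<union> t ` {i, j, k} = {x, y, z}"
    by (auto simp: ends_def)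
  moreover have "card {x, y, z} = 3" "card {i, j, k} = 3"
    using \<open>z \<noteq> x\<close> \<open>z \<noteq> y\<close> xy V by auto
  ultimately show False
    using forest[of "{i, j, k}"] V by simp
qed

lemma arr_loop [simp]: "arr Q i i = 0"
  using cluster by (simp add: cluster_quiver_def)

lemma arr_antisym: "0 < arr Q i j \<Longrightarrow> arr Q j i = 0"
  using cluster by (metis cluster_quiver_def gr0I)

lemma arr_le_1: "i \<in> verts Q \<Longrightarrow> j \<in> verts Q \<Longrightarrow> arr Q i j \<le> 1"
  using arrows[of i j] by (cases "i = j") (auto simp: arrows_between_def split: if_splits)

lemma arr_common_end:
  assumes "0 < arr Q i j"
  shows "i \<in> verts Q" "j \<in> verts Q" "i \<noteq> j" "\<exists>x. x \<in> ends s t i \<inter> ends s t j"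
proof -
  show V: "i \<in> verts Q" "j \<in> verts Q" "i \<noteq> j"
    using assms cluster by (auto simp: cluster_quiver_def)
  show "\<exists>x. x \<in> ends s t i \<inter> ends s t j"
    using arrows[OF V] assms by (auto simp: arrows_between_def split: if_splits)
qed

lemma common_end_arr:
  assumes "i \<in> verts Q" "j \<in> verts Q" "i \<noteq> j" "x \<in> ends s t i" "x \<in> ends s t j"
  shows "arr Q i j = 1 \<and> arr Q j i = 0 \<or> arr Q i j = 0 \<and> arr Q j i = 1"
  using arrows[OF assms(1-3)] assms(4,5) by (auto simp: arrows_between_def split: if_splits)

lemma no_common_end_arr:
  assumes "i \<in> verts Q" "j \<in> verts Q" "i \<noteq> j" "ends s t i \<inter> ends s t j = {}"
  shows "arr Q i j = 0"
  using arrows[OF assms(1-3)] assms(4) by (auto simp: arrows_between_def split: if_splits)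

end

section \<open>Mutation slides edges\<close>

lemma verts_mutate [simp]: "verts (mutate v Q) = verts Q"
  by (simp add: mutate_def delete_2cycles_def reverse_at_def add_paths_def)

text \<open>
  Without 2-cycles at \<open>v\<close>, truncated subtraction does nothing to the arrows at \<open>v\<close>.
\<close>

lemma arr_mutate:
  assumes "cluster_quiver Q"
  shows "arr (mutate v Q) i j = (if i = v \<or> j = v then arr Q j i
    else arr Q i j + arr Q i v * arr Q v j - (arr Q j i + arr Q j v * arr Q v i))"
proof -
  have "arr Q j i - arr Q i j = arr Q j i"
    using assms by (metis cluster_quiver_def diff_zero diff_0_eq_0 gr0I)
  moreover have "arr Q v v = 0"
    using assms by (simp add: cluster_quiver_def)
  ultimately show ?thesis
    by (auto simp: mutate_def delete_2cycles_def reverse_at_def add_paths_def)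
qed

lemma cluster_quiver_mutate:
  assumes "cluster_quiver Q"
  shows "cluster_quiver (mutate v Q)"
proof -
  have V: "i \<in> verts Q \<and> j \<in> verts Q" if "arr Q i j \<noteq> 0" for i j
    using assms that by (simp add: cluster_quiver_def)
  have "arr Q i j = 0 \<or> arr Q j i = 0" "arr Q i i = 0" for i j
    using assms by (auto simp: cluster_quiver_def)
  moreover have "i \<in> verts Q \<and> j \<in> verts Q" if "arr (mutate v Q) i j \<noteq> 0" for i j
  proof (cases "i = v \<or> j = v")
    case True
    then show ?thesis using that V by (auto simp: arr_mutate[OF assms])
  next
    case False
    then have "arr Q i j + arr Q i v * arr Q v j \<noteq> 0"
      using that by (metis arr_mutate[OF assms] diff_0_eq_0)
    then have "arr Q i j \<noteq> 0 \<or> arr Q i v \<noteq> 0 \<and> arr Q v j \<noteq> 0"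
      by (metis add_is_0 mult_is_0)
    then show ?thesis using V by blast
  qed
  moreover have "finite (verts Q)"
    using assms by (simp add: cluster_quiver_def)
  ultimately show ?thesis
    by (auto simp: cluster_quiver_def[of "mutate v Q"] arr_mutate[OF assms])
qed

lemma mutate_mutate:
  assumes "cluster_quiver Q"
  shows "mutate v (mutate v Q) = Q"
proof -
  note Q' = cluster_quiver_mutate[OF assms]
  have "arr (mutate v (mutate v Q)) i j = arr Q i j" for i j
  proof -
    have "arr Q i j = 0 \<or> arr Q j i = 0"
      using assms by (auto simp: cluster_quiver_def)
    then have "arr Q i j + p - (arr Q j i + q) + q - (arr Q j i + q - (arr Q i j + p) + p) = arr Q i j"
      for p q by auto
    from this[of "arr Q i v * arr Q v j" "arr Q j v * arr Q v i"] show ?thesis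
      by (simp add: arr_mutate[OF Q'] arr_mutate[OF assms] mult.commute)
  qed
  moreover have "verts (mutate v (mutate v Q)) = verts Q"
    by simp
  ultimately show ?thesis
    by (intro quiver.equality) auto
qed

text \<open>
  One end map of the forest after mutation at \<open>v\<close>, where \<open>e\<close> is the old end map. On transpositions,
  this is conjugation by the one of \<open>v\<close>, applied to the targets of arrows out of \<open>v\<close>.
\<close>

definition flip :: "'a quiver \<Rightarrow> ('a \<Rightarrow> 'p) \<Rightarrow> ('a \<Rightarrow> 'p) \<Rightarrow> 'a \<Rightarrow> ('a \<Rightarrow> 'p) \<Rightarrow> 'a \<Rightarrow> 'p" where
  "flip Q s t v e i = (if 0 < arr Q v i then Transposition.transpose (s v) (t v) (e i) else e i)"

context forest_model
begin

lemma ends_flip: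
  "x \<in> ends (flip Q s t v s) (flip Q s t v t) i \<longleftrightarrow>
   (if 0 < arr Q v i then Transposition.transpose (s v) (t v) x else x) \<in> ends s t i"
  by (auto simp: ends_def flip_def Transposition.transpose_def split: if_splits)

lemma flip_ends_v: "ends (flip Q s t v s) (flip Q s t v t) v = ends s t v"
  by (simp add: ends_def flip_def)

text \<open>
  A set of edges containing \<open>v\<close> touches the same points before and after sliding. A set that omits
  \<open>v\<close> gains at most one point when \<open>v\<close> is added to it, provided that it touches \<open>v\<close>; this is enough
  because adding \<open>v\<close> costs exactly one edge.
\<close>

lemma flip_forest:
  assumes v: "v \<in> verts Q" and F: "F \<subseteq> verts Q" "F \<noteq> {}"
  shows "card F < card (flip Q s t v s ` F \<union> flip Q s t v t ` F)"
proof -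
  let ?s = "flip Q s t v s" and ?t = "flip Q s t v t"
  have finF: "finite F" using F finite_verts finite_subset by blast
  have sv: "?s v = s v" "?t v = t v" by (auto simp: flip_def)
  have with_v: "?s ` G \<union> ?t ` G = s ` G \<union> t ` G" if "v \<in> G" for G
  proof -
    have absorb: "(\<Union>i\<in>G. A i) = (\<Union>i\<in>G. A i \<union> A v)" for A :: "'a \<Rightarrow> 'p set"
      using that by blast
    have "ends ?s ?t i \<union> ends s t v = ends s t i \<union> ends s t v" for i
      by (auto simp: ends_def flip_def Transposition.transpose_def)
    then show ?thesis
      unfolding image_Un_eq_Union_ends absorb[of "ends _ _"] flip_ends_v by simp
  qed
  show ?thesis
  proof (cases "v \<in> F")
    case True
    then show ?thesis using with_v forest F by simp
  next
    case False
    let ?V = "?s ` F \<union> ?t ` F"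
    have finV: "finite ?V" using finF by simp
    have "card F + 1 < card (?s ` insert v F \<union> ?t ` insert v F)"
      using forest[of "insert v F"] with_v[of "insert v F"] F v finF False by simp
    also have "?s ` insert v F \<union> ?t ` insert v F = insert (s v) (insert (t v) ?V)"
      by (auto simp: sv)
    finally have less: "card F + 1 < card (insert (s v) (insert (t v) ?V))" .
    show ?thesis
    proof (cases "s v \<in> ?V \<or> t v \<in> ?V")
      case True
      then have "card (insert (s v) (insert (t v) ?V)) \<le> card ?V + 1"
        using finV by (auto simp: card_insert_if insert_absorb)
      then show ?thesis using less by simp
    next
      case False
      \<comment> \<open>No moved edge lies in \<open>F\<close>, since a moved edge still has an end on \<open>v\<close>.\<close>
      have "\<not> 0 < arr Q v i" if "i \<in> F" for i
      proof
        assume a: "0 < arr Q v i"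
        then obtain x where x: "x \<in> ends s t v \<inter> ends s t i"
          using arr_common_end by blast
        then have "s v \<in> {?s i, ?t i} \<or> t v \<in> {?s i, ?t i}"
          using a by (auto simp: ends_def flip_def Transposition.transpose_def)
        moreover have "?s i \<in> ?V" "?t i \<in> ?V" using that by auto
        ultimately show False using False by (metis insertE singletonD)
      qed
      then have "?V = s ` F \<union> t ` F"
        by (auto simp: flip_def)
      then show ?thesis using forest F by simp
    qed
  qed
qed

text \<open>
  At each end of \<open>v\<close> there is at most one edge with an arrow into \<open>v\<close> and at most one with an arrow
  out of \<open>v\<close>, by the orientation of corners. So two edges that meet at an end of \<open>v\<close> after the mutation
  are of different kinds: one has stayed there and the other has moved there.
\<close>

lemma flip_in_out:
  assumes V: "v \<in> verts Q" "a \<in> verts Q" "b \<in> verts Q" "distinct [v, a, b]"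
    and a: "x \<in> ends (flip Q s t v s) (flip Q s t v t) a"
    and b: "x \<in> ends (flip Q s t v s) (flip Q s t v t) b"
    and x: "x \<in> ends s t v"
  shows "0 < arr Q a v \<and> 0 < arr Q v b \<or> 0 < arr Q v a \<and> 0 < arr Q b v"
proof -
  let ?x = "Transposition.transpose (s v) (t v) x"
  have x': "?x \<in> ends s t v"
    using x by (auto simp: ends_def)
  \<comment> \<open>Each edge now at \<open>x\<close> has moved there from the other end \<open>?x\<close> of \<open>v\<close>, or was at \<open>x\<close> before.\<close>
  have io: "0 < arr Q v c \<and> ?x \<in> ends s t c \<or> 0 < arr Q c v \<and> x \<in> ends s t c"
    if "c \<in> verts Q" "c \<noteq> v" "x \<in> ends (flip Q s t v s) (flip Q s t v t) c" for c
    using that common_end_arr[of c v x] V(1) x by (auto simp: ends_flip split: if_splits)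
  have "\<not> (0 < arr Q v a \<and> 0 < arr Q v b \<and> ?x \<in> ends s t a \<and> ?x \<in> ends s t b)"
    using cyclic[of v a b ?x] cyclic[of a b v ?x] arr_antisym[of v b] V x' by auto
  moreover have "\<not> (0 < arr Q a v \<and> 0 < arr Q b v \<and> x \<in> ends s t a \<and> x \<in> ends s t b)"
    using cyclic[of a v b x] arr_antisym[of v b] V x by auto
  ultimately show ?thesis
    using io[of a] io[of b] V a b by auto
qed

text \<open>
  A path \<open>a \<rightarrow> v \<rightarrow> b\<close> through one corner lies on a triangle, whose arrow \<open>b \<rightarrow> a\<close> is cancelled when \<open>b\<close>
  slides away. A path through both ends of \<open>v\<close> gives a new arrow \<open>a \<rightarrow> b\<close>, and \<open>b\<close> slides to the end
  of \<open>v\<close> at which it meets \<open>a\<close>.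
\<close>

lemma flip_arr_through:
  assumes av: "0 < arr Q a v" and vb: "0 < arr Q v b" and "a \<noteq> b"
  shows "if ends (flip Q s t v s) (flip Q s t v t) a \<inter> ends (flip Q s t v s) (flip Q s t v t) b = {}
    then arr (mutate v Q) a b = 0 \<and> arr (mutate v Q) b a = 0
    else arr (mutate v Q) a b = 1 \<and> arr (mutate v Q) b a = 0"
proof -
  let ?T = "Transposition.transpose (s v) (t v)"
  note A = arr_common_end[OF av] and B = arr_common_end[OF vb]
  obtain x where x: "x \<in> ends s t a \<inter> ends s t v" using A(4) by blast
  obtain y where y: "y \<in> ends s t v \<inter> ends s t b" using B(4) by blast
  have one: "arr Q a v = 1" "arr Q v b = 1" "arr Q v a = 0" "arr Q b v = 0"
    using arr_le_1[of a v] arr_le_1[of v b] arr_antisym[of a v] arr_antisym[of v b] av vb A B by auto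
  have E: "z \<in> ends (flip Q s t v s) (flip Q s t v t) a \<longleftrightarrow> z \<in> ends s t a"
    "z \<in> ends (flip Q s t v s) (flip Q s t v t) b \<longleftrightarrow> ?T z \<in> ends s t b" for z
    using one by (auto simp: ends_flip)
  have st: "s v \<noteq> t v" using not_loop A(2) by blast
  show ?thesis
  proof (cases "x = y")
    case True
    then have "0 < arr Q b a"
      using cyclic[of v b a x] vb x y A B assms(3) by auto
    then have ba: "arr Q b a = 1" "arr Q a b = 0"
      using arr_le_1[of b a] arr_antisym[of b a] A B by auto
    have False if "z \<in> ends s t a" "?T z \<in> ends s t b" for z
    proof (cases "z \<in> ends s t v")
      case z: True
      then have "z = x"
        using at_most_one_common_end[of a v z x] x that A by auto
      moreover have "?T z \<in> ends s t v"
        using z by (auto simp: ends_def)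
      then have "?T z = y"
        using at_most_one_common_end[of b v "?T z" y] y that B by auto
      ultimately show False
        using True st z by (auto simp: ends_def)
    next
      case z: False
      then have "?T z = z" by (auto simp: ends_def)
      then have "z = x"
        using at_most_one_common_end[of a b z x] x y True that A B assms(3) by auto
      then show False using z x by auto
    qed
    then have "ends (flip Q s t v s) (flip Q s t v t) a \<inter> ends (flip Q s t v s) (flip Q s t v t) b = {}"
      using E by blast
    then show ?thesis
      using one ba A B by (simp add: arr_mutate[OF cluster])
  next
    case False
    then have "?T x = y" using x y by (auto simp: ends_def)
    then have "x \<in> ends (flip Q s t v s) (flip Q s t v t) a \<inter> ends (flip Q s t v s) (flip Q s t v t) b"
      using E x y by auto
    moreover have "ends s t a \<inter> ends s t b = {}"
      using no_triangle[of a v b x y] x y False A B assms(3) by auto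
    then have "arr Q a b = 0" "arr Q b a = 0"
      using no_common_end_arr[of a b] no_common_end_arr[of b a] A B assms(3) by auto
    ultimately show ?thesis
      using one A B by (auto simp add: arr_mutate[OF cluster])
  qed
qed

text \<open>
  Pairs of edges that are not linked by a path through \<open>v\<close> keep their arrows, and whether they meet:
  either both can be regarded as slid or neither, since sliding does not change an edge disjoint
  from \<open>v\<close>. The other pairs are covered by \<open>flip_arr_through\<close>. Three edges that meet after the mutation
  do so away from \<open>v\<close>, where nothing has changed, or at an end of \<open>v\<close>, where by \<open>flip_in_out\<close> they are
  \<open>v\<close> and one edge of each kind.
\<close>

lemma forest_model_mutate:
  assumes v: "v \<in> verts Q"
  shows "forest_model (mutate v Q) (flip Q s t v s) (flip Q s t v t)"
proof
  let ?T = "Transposition.transpose (s v) (t v)"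
  let ?E = "ends (flip Q s t v s) (flip Q s t v t)"
  show "cluster_quiver (mutate v Q)"
    by (rule cluster_quiver_mutate[OF cluster])
  show "card F < card (flip Q s t v s ` F \<union> flip Q s t v t ` F)"
    if "F \<subseteq> verts (mutate v Q)" "F \<noteq> {}" for F
    using flip_forest[OF v] that by simp
  show "arrows_between (mutate v Q) i j = (if ?E i \<inter> ?E j = {} then 0 else 1)"
    if "i \<in> verts (mutate v Q)" "j \<in> verts (mutate v Q)" "i \<noteq> j" for i j
  proof -
    have V: "i \<in> verts Q" "j \<in> verts Q" using that by auto
    have out: "?E k = ?T ` ends s t k" if "0 < arr Q v k" for k
      using that by (simp add: ends_def flip_def)
    have other: "?E k = ends s t k" if "\<not> 0 < arr Q v k" for k
      using that by (simp add: ends_def flip_def)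
    \<comment> \<open>An edge disjoint from \<open>v\<close> can be treated as slid.\<close>
    have fixed: "?E k = ?T ` ends s t k"
      if "k \<in> verts Q" "k \<noteq> v" "\<not> 0 < arr Q v k" "\<not> 0 < arr Q k v" for k
    proof -
      have "s v \<notin> ends s t k" "t v \<notin> ends s t k"
        using common_end_arr[of k v "s v"] common_end_arr[of k v "t v"] that v by (auto simp: ends_def)
      then show ?thesis using that other by simp
    qed
    have at_v: "?E v \<inter> ?E k = {} \<longleftrightarrow> ends s t v \<inter> ends s t k = {}" for k
    proof (cases "0 < arr Q v k")
      case True
      have "ends s t v = ?T ` ends s t v" by (auto simp: ends_def)
      then have "ends s t v \<inter> ?E k = ?T ` (ends s t v \<inter> ends s t k)"
        using out[OF True] by (metis image_Int[OF inj_transpose])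
      then show ?thesis by (simp add: flip_ends_v)
    next
      case False
      then show ?thesis by (simp add: flip_ends_v other)
    qed
    consider "i = v" | "j = v" | "i \<noteq> v" "j \<noteq> v" "0 < arr Q i v" "0 < arr Q v j"
      | "i \<noteq> v" "j \<noteq> v" "0 < arr Q j v" "0 < arr Q v i"
      | "i \<noteq> v" "j \<noteq> v" "\<not> (0 < arr Q i v \<and> 0 < arr Q v j)" "\<not> (0 < arr Q j v \<and> 0 < arr Q v i)"
      by (cases "i = v"; cases "j = v"; cases "0 < arr Q i v \<and> 0 < arr Q v j";
          cases "0 < arr Q j v \<and> 0 < arr Q v i") simp_all
    then show ?thesis
    proof cases
      case 1
      then show ?thesis
        using at_v[of j] arrows[OF V \<open>i \<noteq> j\<close>] that(3)
        by (simp add: arrows_between_def arr_mutate[OF cluster])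
    next
      case 2
      then show ?thesis
        using at_v[of i] arrows[OF V \<open>i \<noteq> j\<close>] that(3)
        by (simp add: arrows_between_def arr_mutate[OF cluster] Int_commute)
    next
      case 3
      then show ?thesis
        using flip_arr_through[of i v j] \<open>i \<noteq> j\<close> by (auto simp: arrows_between_def split: if_splits)
    next
      case 4
      then show ?thesis
        using flip_arr_through[of j v i] \<open>i \<noteq> j\<close> by (auto simp: arrows_between_def split: if_splits)
    next
      case 5
      have "arrows_between (mutate v Q) i j = arrows_between Q i j"
        using 5 arr_antisym[of i j]
        by (cases "arr Q i j = 0") (auto simp: arrows_between_def arr_mutate[OF cluster])
      moreover have "?E i \<inter> ?E j = {} \<longleftrightarrow> ends s t i \<inter> ends s t j = {}"
      proof (cases "0 < arr Q v i \<or> 0 < arr Q v j")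
        case True
        then have "?E i = ?T ` ends s t i" "?E j = ?T ` ends s t j"
          using out fixed[of i] fixed[of j] 5 V by metis+
        then show ?thesis by (simp flip: image_Int[OF inj_transpose])
      next
        case False
        then show ?thesis using other by simp
      qed
      ultimately show ?thesis using arrows[OF V \<open>i \<noteq> j\<close>] by simp
    qed
  qed
  show "0 < arr (mutate v Q) j k"
    if ijk: "{i, j, k} \<subseteq> verts (mutate v Q)" "distinct [i, j, k]" and x: "x \<in> ?E i \<inter> ?E j \<inter> ?E k"
      and ij: "0 < arr (mutate v Q) i j" for i j k x
  proof (cases "x \<in> ends s t v")
    case False
    then have Tx: "?T x = x" by (auto simp: ends_def)
    have neq: "i \<noteq> v" "j \<noteq> v" "k \<noteq> v"
      using x False flip_ends_v by auto
    have xE: "x \<in> ends s t i \<inter> ends s t j \<inter> ends s t k"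
      using x Tx by (auto simp: ends_flip split: if_splits)
    have same: "arr (mutate v Q) a b = arr Q a b"
      if "a \<in> {i, j, k}" "b \<in> {i, j, k}" "a \<noteq> b" for a b
    proof -
      have V: "a \<in> verts Q" "b \<in> verts Q" "a \<noteq> v" "b \<noteq> v" using that ijk neq by auto
      have xab: "x \<in> ends s t a \<inter> ends s t b" using xE that by auto
      \<comment> \<open>Otherwise \<open>a\<close>, \<open>b\<close> and \<open>v\<close> would form a triangle of the forest.\<close>
      have "\<not> ((0 < arr Q a v \<or> 0 < arr Q v a) \<and> (0 < arr Q b v \<or> 0 < arr Q v b))"
      proof
        assume "(0 < arr Q a v \<or> 0 < arr Q v a) \<and> (0 < arr Q b v \<or> 0 < arr Q v b)"
        moreover have "\<exists>y. y \<in> ends s t c \<inter> ends s t v" if "0 < arr Q c v \<or> 0 < arr Q v c" for c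
          using that arr_common_end(4)[of c v] arr_common_end(4)[of v c] by blast
        ultimately obtain y z where "y \<in> ends s t b \<inter> ends s t v" "z \<in> ends s t a \<inter> ends s t v"
          by blast
        then have "x = y"
          using no_triangle[of a b v x y z] V v xab \<open>a \<noteq> b\<close> by auto
        then show False using \<open>y \<in> _\<close> False by auto
      qed
      then show ?thesis
        using V arr_antisym[of a b]
        by (cases "arr Q a b = 0") (auto simp: arr_mutate[OF cluster])
    qed
    then have "0 < arr Q i j" using ij ijk by auto
    then have "0 < arr Q j k" using cyclic[of i j k x] ijk xE by auto
    then show ?thesis using same[of j k] ijk by auto
  next
    case xv: True
    have through: "arr (mutate v Q) a b = 1"
      if "0 < arr Q a v" "0 < arr Q v b" "a \<noteq> b" "x \<in> ?E a" "x \<in> ?E b" for a b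
      using flip_arr_through[OF that(1-3)] that(4,5) by (auto split: if_splits)
    note io = flip_in_out[OF v _ _ _ _ _ xv]
    have P: "0 < arr (mutate v Q) v a \<longleftrightarrow> 0 < arr Q a v" "0 < arr (mutate v Q) a v \<longleftrightarrow> 0 < arr Q v a" for a
      by (auto simp: arr_mutate[OF cluster])
    consider "i = v" | "j = v" | "k = v" | "i \<noteq> v" "j \<noteq> v" "k \<noteq> v" by blast
    then show ?thesis
    proof cases
      case 1
      then show ?thesis
        using io[of j k] x ijk ij P[of j] through[of j k] arr_antisym[of v j] by auto
    next
      case 2
      then show ?thesis
        using io[of i k] x ijk ij P[of i] P[of k] arr_antisym[of v i] by auto
    next
      case 3
      have "arr (mutate v Q) i j = 0" if "0 < arr Q v i" "0 < arr Q j v"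
        using flip_arr_through[OF that(2,1)] ijk by (auto split: if_splits)
      then show ?thesis
        using 3 io[of i j] x ijk ij P[of j] by auto
    next
      case 4
      then show ?thesis
        using io[of i j] io[of j k] io[of i k] x ijk
          arr_antisym[of v i] arr_antisym[of v j] arr_antisym[of v k] by auto
    qed
  qed
qed

end

section \<open>Forest models in mutation type A\<close>

lemma cluster_quiver_full_subquiver:
  assumes "cluster_quiver Q" "I \<subseteq> verts Q"
  shows "cluster_quiver (full_subquiver Q I)"
  using assms by (auto simp: cluster_quiver_def full_subquiver_def intro: finite_subset)

lemma (in forest_model) forest_model_full_subquiver:
  assumes I: "I \<subseteq> verts Q"
  shows "forest_model (full_subquiver Q I) s t"
proof
  show "cluster_quiver (full_subquiver Q I)"
    using cluster_quiver_full_subquiver[OF cluster I] .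
next
  fix F assume "F \<subseteq> verts (full_subquiver Q I)" "F \<noteq> {}"
  then show "card F < card (s ` F \<union> t ` F)"
    using I forest[of F] by (simp add: full_subquiver_def)
next
  fix i j assume "i \<in> verts (full_subquiver Q I)" "j \<in> verts (full_subquiver Q I)" "i \<noteq> j"
  then show "arrows_between (full_subquiver Q I) i j = (if ends s t i \<inter> ends s t j = {} then 0 else 1)"
    using I arrows[of i j] by (simp add: full_subquiver_def arrows_between_def subset_iff)
next
  fix i j k x
  assume "{i, j, k} \<subseteq> verts (full_subquiver Q I)" "distinct [i, j, k]"
    "x \<in> ends s t i \<inter> ends s t j \<inter> ends s t k" "0 < arr (full_subquiver Q I) i j"
  then show "0 < arr (full_subquiver Q I) j k"
    using I cyclic[of i j k x] by (auto simp: full_subquiver_def)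
qed

text \<open>
  The \<open>i\<close>-th vertex of the diagram is the edge of a path from \<open>i\<close> to \<open>i + 1\<close>. For a set \<open>F\<close> of such
  edges, the right end of the last one is a point that is the left end of no edge in \<open>F\<close>.
\<close>

lemma forest_model_dynkin_A_orientation:
  fixes Q :: "'a quiver"
  assumes "dynkin_A_orientation n Q"
  shows "\<exists>s t :: 'a \<Rightarrow> nat. forest_model Q s t"
proof -
  obtain f where cl: "cluster_quiver Q" and f: "bij_betw f {1..n} (verts Q)"
    and arr: "\<And>i j. i \<in> {1..n} \<Longrightarrow> j \<in> {1..n} \<Longrightarrow>
      arrows_between Q (f i) (f j) = (if j = Suc i \<or> i = Suc j then 1 else 0)"
    using assms by (auto simp: dynkin_A_orientation_def)
  define s where "s = inv_into {1..n} f"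
  define t where "t i = Suc (s i)" for i
  have s: "s i \<in> {1..n}" "f (s i) = i" if "i \<in> verts Q" for i
    using that f by (auto simp: s_def bij_betw_def inv_into_into f_inv_into_f simp del: atLeastAtMost_iff)
  then have inj: "inj_on s (verts Q)"
    by (metis inj_onI)
  have "forest_model Q s t"
  proof
    show "cluster_quiver Q" by (fact cl)
  next
    fix F assume F: "F \<subseteq> verts Q" "F \<noteq> {}"
    then have fin: "finite F"
      using cl by (auto simp: cluster_quiver_def intro: finite_subset)
    have "Suc (Max (s ` F)) \<notin> s ` F"
      using fin by (metis Max_ge finite_imageI not_less_eq_eq order_refl)
    then have "card F < card (insert (Suc (Max (s ` F))) (s ` F))"
      using fin card_image[OF inj_on_subset[OF inj F(1)]] by simp
    also have "\<dots> \<le> card (s ` F \<union> t ` F)"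
    proof (rule card_mono)
      have "Max (s ` F) \<in> s ` F"
        using fin F by simp
      then show "insert (Suc (Max (s ` F))) (s ` F) \<subseteq> s ` F \<union> t ` F"
        by (auto simp: t_def)
    qed (use fin in simp)
    finally show "card F < card (s ` F \<union> t ` F)" .
  next
    fix i j assume ij: "i \<in> verts Q" "j \<in> verts Q" "i \<noteq> j"
    then have "s i \<noteq> s j" using inj by (auto dest: inj_onD)
    then show "arrows_between Q i j = (if ends s t i \<inter> ends s t j = {} then 0 else 1)"
      using arr[of "s i" "s j"] ij s by (auto simp: ends_def t_def)
  next
    fix i j k x
    assume ijk: "{i, j, k} \<subseteq> verts Q" "distinct [i, j, k]" and x: "x \<in> ends s t i \<inter> ends s t j \<inter> ends s t k"
    have "s i \<noteq> s j" "s i \<noteq> s k" "s j \<noteq> s k" using ijk inj by (auto dest: inj_onD)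
    \<comment> \<open>A point of a path lies on at most two edges.\<close>
    then have False using x by (auto simp: ends_def t_def)
    then show "0 < arr Q j k" ..
  qed
  then show ?thesis by blast
qed

text \<open>
  The mutations lead from \<open>Q\<close> to a Dynkin quiver, and the model is carried back along them.
\<close>

lemma forest_model_mutation_dynkin_A:
  fixes Q :: "'a quiver"
  assumes "mutation_dynkin_A n Q"
  shows "\<exists>s t :: 'a \<Rightarrow> nat. forest_model Q s t"
proof -
  obtain Q' where Q': "mutation_equivalent Q Q'" "dynkin_A_orientation n Q'" and cl: "cluster_quiver Q"
    using assms by (auto simp: mutation_dynkin_A_def)
  from Q'(1) cl show ?thesis
    unfolding mutation_equivalent_def
  proof (induction rule: converse_rtranclp_induct)
    case base
    then show ?case using forest_model_dynkin_A_orientation[OF Q'(2)] by simp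
  next
    case (step P P')
    then obtain v where v: "v \<in> verts P" "P' = mutate v P" by blast
    have "\<exists>s t :: 'a \<Rightarrow> nat. forest_model (mutate v P) s t"
      using step.IH cluster_quiver_mutate[OF step.prems] unfolding v(2) .
    then obtain s t :: "'a \<Rightarrow> nat" where "forest_model (mutate v P) s t"
      by (elim exE)
    then have "forest_model (mutate v (mutate v P)) (flip (mutate v P) s t v s) (flip (mutate v P) s t v t)"
      using v(1) by (intro forest_model.forest_model_mutate) simp_all
    then show ?case
      unfolding mutate_mutate[OF step.prems] by (intro exI)
  qed
qed

text \<open>
  The points of the components are made disjoint by tagging them with the vertex set of the component.
\<close>

lemma forest_model_glue:
  fixes Q :: "'a quiver"
  assumes cl: "cluster_quiver Q"
    and comp: "\<And>C. C \<in> connected_components Q \<Longrightarrow> \<exists>s t :: 'a \<Rightarrow> 'p. forest_model C s t"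
  shows "\<exists>s t :: 'a \<Rightarrow> 'a set \<times> 'p. forest_model Q s t"
proof -
  define K where "K i = {j \<in> verts Q. connected_in Q i j}" for i
  have conn_refl: "connected_in Q i i" for i
    by (simp add: connected_in_def)
  have conn_arrow: "connected_in Q i j" if "0 < arrows_between Q i j" for i j
    using that unfolding connected_in_def by (rule r_into_rtranclp)
  have conn_trans: "connected_in Q i k" if "connected_in Q i j" "connected_in Q j k" for i j k
    using that unfolding connected_in_def by (rule rtranclp_trans)
  have conn_sym: "connected_in Q j i" if "connected_in Q i j" for i j
  proof -
    have "symp (connected_in Q)"
      unfolding connected_in_def by (intro symp_rtranclp sympI) (auto simp: arrows_between_def)
    then show ?thesis using that by (rule sympD)
  qed
  have K_eq: "K i = K j \<longleftrightarrow> connected_in Q i j" if "j \<in> verts Q" for i j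
  proof
    assume "K i = K j"
    moreover have "j \<in> K j" using that conn_refl by (simp add: K_def)
    ultimately show "connected_in Q i j" by (auto simp: K_def)
  next
    assume "connected_in Q i j"
    then show "K i = K j" unfolding K_def by (intro Collect_cong) (metis conn_trans conn_sym)
  qed
  have in_K: "j \<in> K i \<longleftrightarrow> j \<in> verts Q \<and> K j = K i" if "i \<in> verts Q" for i j
    using K_eq[of j i] by (auto simp: K_def)
  have "\<forall>Z. Z \<in> K ` verts Q \<longrightarrow> (\<exists>s t. forest_model (full_subquiver Q Z) (s :: 'a \<Rightarrow> 'p) t)"
    using comp by (auto simp: connected_components_def K_def)
  then obtain S T :: "'a set \<Rightarrow> 'a \<Rightarrow> 'p"
    where st: "\<And>Z. Z \<in> K ` verts Q \<Longrightarrow> forest_model (full_subquiver Q Z) (S Z) (T Z)"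
    by metis
  define s where "s i = (K i, S (K i) i)" for i
  define t where "t i = (K i, T (K i) i)" for i
  have ends: "(Z, y) \<in> ends s t i \<longleftrightarrow> Z = K i \<and> y \<in> ends (S Z) (T Z) i" for Z y i
    by (auto simp: ends_def s_def t_def)
  have "forest_model Q s t"
  proof
    show "cluster_quiver Q" by (fact cl)
  next
    fix F assume F: "F \<subseteq> verts Q" "F \<noteq> {}"
    then have fin: "finite F"
      using cl by (auto simp: cluster_quiver_def intro: finite_subset)
    let ?G = "\<lambda>Z. {i \<in> F. K i = Z}"
    let ?P = "\<lambda>Z. S Z ` ?G Z \<union> T Z ` ?G Z"
    have "card F = card (\<Union>Z\<in>K ` F. ?G Z)"
      by (rule arg_cong[of _ _ card]) auto
    also have "\<dots> = (\<Sum>Z\<in>K ` F. card (?G Z))"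
      using fin by (intro card_UN_disjoint) auto
    also have "\<dots> < (\<Sum>Z\<in>K ` F. card ({Z} \<times> ?P Z))"
    proof (rule sum_strict_mono)
      fix Z assume Z: "Z \<in> K ` F"
      then obtain i where i: "i \<in> verts Q" "Z = K i" using F by auto
      have "?G Z \<subseteq> verts (full_subquiver Q Z)"
        using F i in_K[OF i(1)] by (auto simp: full_subquiver_def)
      moreover have "?G Z \<noteq> {}" using Z by auto
      ultimately show "card (?G Z) < card ({Z} \<times> ?P Z)"
        using forest_model.forest[OF st] i by (simp add: card_cartesian_product_singleton)
    qed (use fin F in auto)
    also have "\<dots> = card (\<Union>Z\<in>K ` F. {Z} \<times> ?P Z)"
      using fin by (subst card_UN_disjoint) auto
    also have "(\<Union>Z\<in>K ` F. {Z} \<times> ?P Z) = s ` F \<union> t ` F"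
      by (auto simp: s_def t_def image_iff)
    finally show "card F < card (s ` F \<union> t ` F)" .
  next
    fix i j assume ij: "i \<in> verts Q" "j \<in> verts Q" "i \<noteq> j"
    show "arrows_between Q i j = (if ends s t i \<inter> ends s t j = {} then 0 else 1)"
    proof (cases "K i = K j")
      case True
      let ?s = "S (K i)" and ?t = "T (K i)"
      have "i \<in> K i" "j \<in> K i" using ij in_K[OF ij(1)] True by auto
      then have "arrows_between Q i j = (if ends ?s ?t i \<inter> ends ?s ?t j = {} then 0 else 1)"
        using forest_model.arrows[OF st, of "K i" i j] ij
        by (auto simp: full_subquiver_def arrows_between_def split: if_splits)
      moreover have "ends s t i \<inter> ends s t j = {} \<longleftrightarrow> ends ?s ?t i \<inter> ends ?s ?t j = {}"
        unfolding disjoint_iff using True by (auto simp: ends)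
      ultimately show ?thesis by simp
    next
      case False
      then have "arrows_between Q i j = 0"
        using K_eq[OF ij(2)] conn_arrow by blast
      moreover have "ends s t i \<inter> ends s t j = {}"
        unfolding disjoint_iff using False by (auto simp: ends)
      ultimately show ?thesis by simp
    qed
  next
    fix i j k x
    assume ijk: "{i, j, k} \<subseteq> verts Q" "distinct [i, j, k]" and x: "x \<in> ends s t i \<inter> ends s t j \<inter> ends s t k"
      and ij: "0 < arr Q i j"
    obtain Z y where "x = (Z, y)" by (cases x)
    with x have Z: "Z = K i" "Z = K j" "Z = K k"
      and y: "y \<in> ends (S Z) (T Z) i \<inter> ends (S Z) (T Z) j \<inter> ends (S Z) (T Z) k"
      by (auto simp: ends)
    have "i \<in> Z" "j \<in> Z" "k \<in> Z" using Z ijk in_K[of i] by auto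
    then show "0 < arr Q j k"
      using forest_model.cyclic[OF st, of Z i j k y] ijk ij Z y by (simp add: full_subquiver_def)
  qed
  then show ?thesis by blast
qed

section \<open>The relations hold for transpositions\<close>

lemma transpose_braid:
  assumes "x \<noteq> y" "x \<noteq> z" "y \<noteq> z"
  shows "Transposition.transpose x y (Transposition.transpose x z (Transposition.transpose x y w))
    = Transposition.transpose x z (Transposition.transpose x y (Transposition.transpose x z w))"
proof -
  consider "w = x" | "w = y" | "w = z" | "w \<noteq> x" "w \<noteq> y" "w \<noteq> z" by blast
  then show ?thesis
    by cases (use assms assms[symmetric] in \<open>simp_all add: Transposition.transpose_def\<close>)
qed

lemma transpose_star:
  assumes "x \<noteq> a" "x \<noteq> b" "x \<noteq> c" "a \<noteq> b" "a \<noteq> c" "b \<noteq> c"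
  shows "Transposition.transpose x a (Transposition.transpose x b (Transposition.transpose x c (Transposition.transpose x a w)))
    = Transposition.transpose x b (Transposition.transpose x c (Transposition.transpose x a (Transposition.transpose x b w)))"
proof -
  consider "w = x" | "w = a" | "w = b" | "w = c" | "w \<noteq> x" "w \<noteq> a" "w \<noteq> b" "w \<noteq> c" by blast
  then show ?thesis
    by cases (use assms assms[symmetric] in \<open>simp_all add: Transposition.transpose_def\<close>)
qed

lemma map_fst_pos_word [simp]: "map fst (pos_word w) = w"
  by (induction w) (simp_all add: pos_word_def)

lemma pos_word_append [simp]: "pos_word (u @ v) = pos_word u @ pos_word v"
  by (simp add: pos_word_def)

lemma pos_word_Nil [simp]: "pos_word [] = []"
  by (simp add: pos_word_def)

lemma pos_word_in_gwords [simp]: "pos_word w \<in> gwords S \<longleftrightarrow> set w \<subseteq> S"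
  by (auto simp: pos_word_def gwords_def)

lemma cycle_word_3:
  "cycle_word [i, j, k] 0 = [i, j, k, i]"
  "cycle_word [i, j, k] 1 = [j, k, i, j]"
  "cycle_word [i, j, k] 2 = [k, i, j, k]"
proof -
  have "[0..<4] = [0, 1, 2, 3]"
    by (simp add: upt_conv_Cons)
  then show "cycle_word [i, j, k] 0 = [i, j, k, i]"
    "cycle_word [i, j, k] 1 = [j, k, i, j]"
    "cycle_word [i, j, k] 2 = [k, i, j, k]"
    by (simp_all add: cycle_word_def)
qed

context forest_model
begin

abbreviation edge_swap :: "'a \<Rightarrow> 'p \<Rightarrow> 'p" where
  "edge_swap i \<equiv> Transposition.transpose (s i) (t i)"

definition word_perm :: "'a list \<Rightarrow> 'p \<Rightarrow> 'p" where
  "word_perm w = foldr edge_swap w"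

lemma word_perm_simps [simp]:
  "word_perm [] = id"
  "word_perm (i # w) = edge_swap i \<circ> word_perm w"
  "word_perm (u @ v) = word_perm u \<circ> word_perm v"
  by (simp_all add: word_perm_def, induction u) (simp_all add: comp_assoc)

text \<open>
  The transposition of an edge, written from the point of view of either of its ends.
\<close>

lemma edge_swap_at:
  assumes "x \<in> ends s t i" "i \<in> verts Q"
  obtains y where "y \<noteq> x" "ends s t i = {x, y}" "edge_swap i = Transposition.transpose x y"
proof (cases "x = s i")
  case True
  then show thesis using that[of "t i"] assms(2) not_loop[of i] by (auto simp: ends_def)
next
  case False
  then have "x = t i" using assms(1) by (simp add: ends_def)
  then show thesis
    using that[of "s i"] False by (auto simp: ends_def transpose_commute[of "t i" "s i"])
qed

lemma edge_swap_commute: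
  assumes "ends s t i \<inter> ends s t j = {}"
  shows "edge_swap i \<circ> edge_swap j = edge_swap j \<circ> edge_swap i"
  using assms by (auto simp: ends_def fun_eq_iff Transposition.transpose_def)

lemma edge_swap_braid:
  assumes V: "i \<in> verts Q" "j \<in> verts Q" "i \<noteq> j" and x: "x \<in> ends s t i" "x \<in> ends s t j"
  shows "edge_swap i \<circ> edge_swap j \<circ> edge_swap i = edge_swap j \<circ> edge_swap i \<circ> edge_swap j"
proof -
  obtain y where y: "y \<noteq> x" "ends s t i = {x, y}" "edge_swap i = Transposition.transpose x y"
    using edge_swap_at x(1) V(1) .
  obtain z where z: "z \<noteq> x" "ends s t j = {x, z}" "edge_swap j = Transposition.transpose x z"
    using edge_swap_at x(2) V(2) .
  have "y \<noteq> z"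
    using at_most_one_common_end[OF V, of x y] y z by auto
  then show ?thesis
    using transpose_braid[of x y z] y(1) z(1) by (simp add: fun_eq_iff y(3) z(3))
qed

lemma perm_star:
  assumes V: "i \<in> verts Q" "j \<in> verts Q" "k \<in> verts Q" "distinct [i, j, k]"
    and x: "x \<in> ends s t i" "x \<in> ends s t j" "x \<in> ends s t k"
  shows "word_perm [i, j, k, i] = word_perm [j, k, i, j]"
proof -
  obtain a where a: "a \<noteq> x" "ends s t i = {x, a}" "edge_swap i = Transposition.transpose x a"
    using edge_swap_at x(1) V(1) .
  obtain b where b: "b \<noteq> x" "ends s t j = {x, b}" "edge_swap j = Transposition.transpose x b"
    using edge_swap_at x(2) V(2) .
  obtain c where c: "c \<noteq> x" "ends s t k = {x, c}" "edge_swap k = Transposition.transpose x c"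
    using edge_swap_at x(3) V(3) .
  have "a \<noteq> b" "a \<noteq> c" "b \<noteq> c"
    using at_most_one_common_end[of i j x a] at_most_one_common_end[of i k x a]
      at_most_one_common_end[of j k x b] V a b c by auto
  then show ?thesis
    using transpose_star[of x a b c] a(1) b(1) c(1) by (simp add: fun_eq_iff a(3) b(3) c(3))
qed

text \<open>
  In a longer chordless cycle, consecutive common points differ, since edges two steps apart are
  disjoint. So the edges of the cycle run between consecutive common points, and a cycle of \<open>m\<close> edges
  would touch only \<open>m\<close> points.
\<close>

lemma cycle_length:
  assumes c: "chordless_simple_cycle Q c"
  shows "length c = 3"
proof (rule ccontr)
  define m where "m = length c"
  assume "length c \<noteq> 3"
  with c have m: "4 \<le> m"
    by (simp add: chordless_simple_cycle_def m_def Let_def)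
  have dist: "distinct c" and V: "set c \<subseteq> verts Q"
    and arrow: "\<And>a. a < m \<Longrightarrow> simple_arrow Q (c ! a) (c ! (Suc a mod m))"
    and chordless: "\<And>a b. a < m \<Longrightarrow> b < m \<Longrightarrow> b \<noteq> Suc a mod m \<Longrightarrow> a \<noteq> Suc b mod m \<Longrightarrow>
      arrows_between Q (c ! a) (c ! b) = 0"
    using c by (auto simp: chordless_simple_cycle_def m_def Let_def)
  have "\<exists>x. x \<in> ends s t (c ! a) \<inter> ends s t (c ! (Suc a mod m))" if "a < m" for a
    using arrow[OF that] arr_common_end(4) by (simp add: simple_arrow_def)
  then obtain p where p: "\<And>a. a < m \<Longrightarrow> p a \<in> ends s t (c ! a) \<inter> ends s t (c ! (Suc a mod m))"
    by metis
  have next_ends: "ends s t (c ! (Suc a mod m)) = {p a, p (Suc a mod m)}" if a: "a < m" for a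
  proof -
    define b where "b = Suc a mod m"
    define d where "d = Suc b mod m"
    have lt: "b < m" "d < m" using m by (simp_all add: b_def d_def)
    have b: "b = (if Suc a = m then 0 else Suc a)" using a by (simp add: b_def)
    have d: "d = (if Suc b = m then 0 else Suc b)" using lt by (simp add: d_def)
    have d': "Suc d mod m = (if Suc d = m then 0 else Suc d)" using lt by simp
    have ad: "d \<noteq> b" "a \<noteq> d" "a \<noteq> Suc d mod m"
      unfolding d' using b d m a by (simp_all split: if_splits)
    have "arrows_between Q (c ! a) (c ! d) = 0"
      using chordless[OF a lt(2)] ad by (simp add: b_def)
    moreover have "c ! a \<noteq> c ! d" "c ! a \<in> verts Q" "c ! d \<in> verts Q" "c ! b \<in> verts Q"
      using dist a lt ad V by (auto simp: m_def nth_eq_iff_index_eq)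
    ultimately have "ends s t (c ! a) \<inter> ends s t (c ! d) = {}"
      using arrows[of "c ! a" "c ! d"] by (simp split: if_splits)
    then have "p a \<noteq> p b"
      using p[OF a] p[OF lt(1)] by (auto simp: d_def)
    then show ?thesis
      using ends_eqI[of "c ! b" "p a" "p b"] p[OF a] p[OF lt(1)] \<open>c ! b \<in> verts Q\<close>
      by (simp add: b_def)
  qed
  have "s ` set c \<union> t ` set c \<subseteq> p ` {..<m}"
  proof -
    have "ends s t i \<subseteq> p ` {..<m}" if "i \<in> set c" for i
    proof -
      obtain b where b: "b < m" "i = c ! b"
        using \<open>i \<in> set c\<close> by (auto simp: in_set_conv_nth m_def)
      define a where "a = (if b = 0 then m - 1 else b - 1)"
      have "a < m" "Suc a mod m = b" using b m by (auto simp: a_def)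
      then show ?thesis using next_ends[of a] b by auto
    qed
    then show ?thesis unfolding image_Un_eq_Union_ends by blast
  qed
  then have "card (s ` set c \<union> t ` set c) \<le> m"
    using surj_card_le[OF finite_lessThan] by (metis card_lessThan)
  moreover have "card (set c) = m"
    using dist by (simp add: m_def distinct_card)
  moreover have "set c \<noteq> {}"
    using m by (auto simp: m_def)
  ultimately show False
    using forest[OF V] by simp
qed

text \<open>
  A triangle of the quiver is a star in the forest, so its three transpositions have a common point.
\<close>

lemma perm_cycle_word:
  assumes c: "chordless_simple_cycle Q c" and "a < length c"
  shows "word_perm (cycle_word c a) = word_perm (cycle_word c 0)"
proof -
  have "length c = 3" using cycle_length[OF c] .
  then obtain i j k where ijk: "c = [i, j, k]"
    by (auto simp: length_Suc_conv eval_nat_numeral)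
  have "distinct c" "set c \<subseteq> verts Q"
    and arrow: "\<And>a. a < length c \<Longrightarrow> simple_arrow Q (c ! a) (c ! (Suc a mod length c))"
    using c unfolding chordless_simple_cycle_def Let_def by blast+
  then have V: "i \<in> verts Q" "j \<in> verts Q" "k \<in> verts Q" "distinct [i, j, k]"
    by (simp_all add: ijk)
  have "simple_arrow Q i j" "simple_arrow Q j k" "simple_arrow Q k i"
    using arrow[of 0] arrow[of 1] arrow[of 2] by (simp_all add: ijk)
  then have arr: "0 < arr Q i j" "0 < arr Q j k" "0 < arr Q k i"
    by (simp_all only: simple_arrow_def)
  obtain x where "x \<in> ends s t i \<inter> ends s t j"
    using arr_common_end(4)[OF arr(1)] ..
  moreover obtain y where "y \<in> ends s t j \<inter> ends s t k"
    using arr_common_end(4)[OF arr(2)] ..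
  moreover obtain z where "z \<in> ends s t k \<inter> ends s t i"
    using arr_common_end(4)[OF arr(3)] ..
  ultimately have x: "x \<in> ends s t i" "x \<in> ends s t j" "x \<in> ends s t k"
    using no_triangle[OF V, of x y z] by auto
  have "a = 0 \<or> a = 1 \<or> a = 2" using assms(2) ijk by auto
  then show ?thesis
  proof (elim disjE)
    assume "a = 1"
    then show ?thesis
      using perm_star[OF V x] by (simp only: ijk cycle_word_3)
  next
    assume "a = 2"
    moreover have "distinct [k, i, j]"
      using V(4) by auto
    then have "word_perm [k, i, j, k] = word_perm [i, j, k, i]"
      by (rule perm_star[OF V(3,1,2) _ x(3,1,2)])
    ultimately show ?thesis
      by (simp only: ijk cycle_word_3)
  qed simp
qed

lemma perm_cluster_relation:
  assumes "(u, v) \<in> cluster_relations Q"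
  shows "word_perm (map fst u) = word_perm (map fst v)"
  using assms unfolding cluster_relations_def
proof (elim UnE CollectE exE conjE)
  fix i assume "(u, v) = (pos_word [i, i], [])"
  then show ?thesis by (simp add: fun_eq_iff)
next
  fix i j
  assume *: "(u, v) = (pos_word [i, j], pos_word [j, i])"
    and "i \<in> verts Q" "j \<in> verts Q" "arrows_between Q i j = 0"
  then have "i = j \<or> ends s t i \<inter> ends s t j = {}"
    using arrows[of i j] by (auto split: if_splits)
  then show ?thesis
    using * edge_swap_commute[of i j] by auto
next
  fix i j
  assume *: "(u, v) = (pos_word [i, j, i], pos_word [j, i, j])"
    and V: "i \<in> verts Q" "j \<in> verts Q" and "simple_arrow Q i j \<or> simple_arrow Q j i"
  then have "i \<noteq> j" "\<exists>x. x \<in> ends s t i \<inter> ends s t j"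
    using arr_common_end(3,4)[of i j] arr_common_end(3,4)[of j i] by (auto simp: simple_arrow_def)
  then obtain x where "x \<in> ends s t i" "x \<in> ends s t j" by blast
  from edge_swap_braid[OF V \<open>i \<noteq> j\<close> this] show ?thesis
    using * by (simp add: comp_assoc)
next
  fix c a b
  assume "(u, v) = (pos_word (cycle_word c a), pos_word (cycle_word c b))"
    "chordless_simple_cycle Q c" "a < length c" "b < length c"
  then show ?thesis
    using perm_cycle_word[of c a] perm_cycle_word[of c b] by simp
qed

lemma perm_pres_cong:
  assumes "(u, v) \<in> pres_cong (verts Q) (cluster_relations Q)"
  shows "word_perm (map fst u) = word_perm (map fst v)"
  using assms
proof induction
  case (cancel u v x b)
  then show ?case by (auto simp: fun_eq_iff)
next
  case (rel u v r s)
  then show ?case using perm_cluster_relation by simp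
qed simp_all

end

section \<open>Equal permutations come from the relations\<close>

context forest_model
begin

text \<open>
  Generators are involutions, so positive words represent every element.
\<close>

definition sim :: "'a list \<Rightarrow> 'a list \<Rightarrow> bool" (infix "\<sim>" 50) where
  "u \<sim> v \<longleftrightarrow> (pos_word u, pos_word v) \<in> pres_cong (verts Q) (cluster_relations Q)"

lemma sim_refl: "set w \<subseteq> verts Q \<Longrightarrow> w \<sim> w"
  by (simp add: sim_def pres_cong.refl)

lemma sim_sym: "u \<sim> v \<Longrightarrow> v \<sim> u"
  unfolding sim_def by (rule pres_cong.sym)

lemma sim_trans [trans]: "u \<sim> v \<Longrightarrow> v \<sim> w \<Longrightarrow> u \<sim> w"
  unfolding sim_def by (rule pres_cong.trans)

lemma sim_append: "u \<sim> u' \<Longrightarrow> v \<sim> v' \<Longrightarrow> u @ v \<sim> u' @ v'"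
  unfolding sim_def by (simp add: pres_cong_append)

lemma sim_prefix: "u \<sim> v \<Longrightarrow> set p \<subseteq> verts Q \<Longrightarrow> p @ u \<sim> p @ v"
  by (simp add: sim_append sim_refl)

lemma sim_suffix: "u \<sim> v \<Longrightarrow> set q \<subseteq> verts Q \<Longrightarrow> u @ q \<sim> v @ q"
  by (simp add: sim_append sim_refl)

lemma sim_Cons: "u \<sim> v \<Longrightarrow> i \<in> verts Q \<Longrightarrow> i # u \<sim> i # v"
  using sim_prefix[of u v "[i]"] by simp

lemma sim_relation:
  assumes "(pos_word u, pos_word v) \<in> cluster_relations Q" "set u \<subseteq> verts Q" "set v \<subseteq> verts Q"
  shows "u \<sim> v"
  using pres_cong.rel[of "[]" "verts Q" "[]", OF _ _ assms(1)] assms(2,3) by (simp add: sim_def)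

lemma sim_square: "i \<in> verts Q \<Longrightarrow> [i, i] \<sim> []"
  by (rule sim_relation) (auto simp: cluster_relations_def)

lemma sim_commute:
  assumes "i \<in> verts Q" "j \<in> verts Q" "i \<noteq> j" "ends s t i \<inter> ends s t j = {}"
  shows "[i, j] \<sim> [j, i]"
proof (rule sim_relation)
  have "arrows_between Q i j = 0" using arrows[OF assms(1-3)] assms(4) by simp
  then show "(pos_word [i, j], pos_word [j, i]) \<in> cluster_relations Q"
    using assms(1,2) unfolding cluster_relations_def by blast
qed (use assms in auto)

lemma sim_braid:
  assumes V: "i \<in> verts Q" "j \<in> verts Q" "i \<noteq> j" and x: "x \<in> ends s t i" "x \<in> ends s t j"
  shows "[i, j, i] \<sim> [j, i, j]"
proof (rule sim_relation)
  have "simple_arrow Q i j \<or> simple_arrow Q j i"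
    using common_end_arr[OF V x] by (auto simp: simple_arrow_def arrows_between_def)
  then show "(pos_word [i, j, i], pos_word [j, i, j]) \<in> cluster_relations Q"
    using V unfolding cluster_relations_def by blast
qed (use V in auto)

lemma sim_oriented_triangle:
  assumes V: "{i, j, k} \<subseteq> verts Q" "distinct [i, j, k]"
    and arr: "0 < arr Q i j" "0 < arr Q j k" "0 < arr Q k i"
  shows "[i, j, k, i] \<sim> [j, k, i, j]"
proof (rule sim_relation)
  have simple: "simple_arrow Q a b" if "0 < arr Q a b" for a b
    using that arr_common_end(1,2)[OF that] arr_le_1[of a b] arr_antisym[OF that]
    by (simp add: simple_arrow_def arrows_between_def)
  have all3: "(\<forall>a<3. P a) \<longleftrightarrow> P 0 \<and> P 1 \<and> P 2" for P :: "nat \<Rightarrow> bool"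
    by (auto simp: numeral_3_eq_3 numeral_2_eq_2 less_Suc_eq)
  have length3: "length [i, j, k] = 3" by simp
  have "chordless_simple_cycle Q [i, j, k]"
    unfolding chordless_simple_cycle_def Let_def length3 all3
    using V simple[OF arr(1)] simple[OF arr(2)] simple[OF arr(3)]
    by (simp add: arrows_between_def)
  moreover have "(pos_word (cycle_word c a), pos_word (cycle_word c b)) \<in> cluster_relations Q"
    if "chordless_simple_cycle Q c" "a < length c" "b < length c" for c a b
    using that unfolding cluster_relations_def by blast
  ultimately have "(pos_word (cycle_word [i, j, k] 0), pos_word (cycle_word [i, j, k] 1)) \<in> cluster_relations Q"
    by simp
  then show "(pos_word [i, j, k, i], pos_word [j, k, i, j]) \<in> cluster_relations Q"
    by (simp only: cycle_word_3)
qed (use V in auto)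

text \<open>
  At a common point of three edges, a generator commutes with the conjugate of the second by the third.
  The three-cycle relation \<open>i a b i = a b i a\<close> gives this for \<open>i \<rightarrow> a \<rightarrow> b \<rightarrow> i\<close>: multiply it by \<open>i a\<close> from
  the right and apply the braid relation. Since \<open>j k j = k j k\<close>, the other orientation of the triangle
  gives the same statement.
\<close>

lemma sim_star:
  assumes V: "{i, j, k} \<subseteq> verts Q" "distinct [i, j, k]"
    and x: "x \<in> ends s t i" "x \<in> ends s t j" "x \<in> ends s t k"
  shows "[i, j, k, j] \<sim> [j, k, j, i]"
proof -
  have oriented: "[i, a, b, a] \<sim> [a, b, a, i]"
    if ab: "{i, a, b} \<subseteq> verts Q" "distinct [i, a, b]" "x \<in> ends s t a" "x \<in> ends s t b"
      and "0 < arr Q i a" for a b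
  proof -
    have arr: "0 < arr Q i a" "0 < arr Q a b" "0 < arr Q b i"
      using cyclic[of i a b x] cyclic[of a b i x] ab x(1) \<open>0 < arr Q i a\<close> by auto
    have V': "i \<in> verts Q" "a \<in> verts Q" "b \<in> verts Q" using ab by auto
    have "[i, a, b, a] \<sim> [i, a, b, i, i, a]"
      using sim_append[OF sim_append[OF sim_refl[of "[i, a, b]"] sim_sym[OF sim_square[of i]]] sim_refl[of "[a]"]] V'
      by simp
    also have "\<dots> \<sim> [a, b, i, a, i, a]"
      using sim_suffix[OF sim_oriented_triangle[OF ab(1,2) arr], of "[i, a]"] V' by simp
    also have "\<dots> \<sim> [a, b, a, i, a, a]"
      using sim_append[OF sim_prefix[OF sim_braid[of i a x], of "[a, b]"] sim_refl[of "[a]"]] V' ab x by simp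
    also have "\<dots> \<sim> [a, b, a, i]"
      using sim_prefix[OF sim_square[of a], of "[a, b, a, i]"] V' by simp
    finally show ?thesis .
  qed
  have V': "i \<in> verts Q" "j \<in> verts Q" "k \<in> verts Q" "j \<noteq> k" "i \<noteq> j" using V by auto
  show ?thesis
  proof (cases "0 < arr Q i j")
    case True
    then show ?thesis using oriented[of j k] V x by simp
  next
    case False
    then have "0 < arr Q j i" using common_end_arr[of i j x] V' x by auto
    then have "0 < arr Q i k" using cyclic[of j i k x] V x by auto
    then have *: "[i, k, j, k] \<sim> [k, j, k, i]" using oriented[of k j] V x by auto
    have "[i, j, k, j] \<sim> [i, k, j, k]"
      using sim_Cons[OF sim_braid[of j k x], of i] V' x by simp
    also note *
    also have "[k, j, k, i] \<sim> [j, k, j, i]"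
      using sim_suffix[OF sim_braid[of k j x], of "[i]"] V' x by simp
    finally show ?thesis .
  qed
qed

text \<open>
  The degrees sum up to twice the number of edges, which is less than twice the number of points.
\<close>

lemma exists_leaf:
  assumes W: "W \<subseteq> verts Q" "W \<noteq> {}"
  obtains l e where "e \<in> W" "l \<in> ends s t e" "\<And>f. f \<in> W \<Longrightarrow> l \<in> ends s t f \<Longrightarrow> f = e"
proof -
  let ?P = "s ` W \<union> t ` W"
  have fin: "finite W" using W(1) finite_verts by (rule finite_subset)
  have P: "?P = (\<Union>i\<in>W. ends s t i)" by (rule image_Un_eq_Union_ends)
  have two: "card {x \<in> ?P. x \<in> ends s t i} = 2" if "i \<in> W" for i
  proof -
    have "{x \<in> ?P. x \<in> ends s t i} = {s i, t i}" using that by (auto simp: ends_def)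
    then show ?thesis using not_loop that W by auto
  qed
  have "(\<Sum>x\<in>?P. card {i \<in> W. x \<in> ends s t i}) = (\<Sum>i\<in>W. 2)"
    using fin two by (intro sum_multicount_gen) auto
  then have less: "(\<Sum>x\<in>?P. card {i \<in> W. x \<in> ends s t i}) < (\<Sum>x\<in>?P. 2)"
    using forest[OF W] by simp
  obtain l where l: "l \<in> ?P" "card {i \<in> W. l \<in> ends s t i} < 2"
  proof (rule ccontr)
    assume "\<not> thesis"
    then have "2 \<le> card {i \<in> W. x \<in> ends s t i}" if "x \<in> ?P" for x
      using that \<open>\<And>l. l \<in> ?P \<Longrightarrow> card {i \<in> W. l \<in> ends s t i} < 2 \<Longrightarrow> thesis\<close> by force
    then have "(\<Sum>x\<in>?P. 2) \<le> (\<Sum>x\<in>?P. card {i \<in> W. x \<in> ends s t i})"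
      by (rule sum_mono)
    then show False using less by simp
  qed
  obtain e where e: "e \<in> W" "l \<in> ends s t e" using l(1) P by blast
  have "card {i \<in> W. l \<in> ends s t i} \<le> Suc 0" using l(2) by simp
  then have "f = e" if "f \<in> W" "l \<in> ends s t f" for f
    using card_le_Suc0_iff_eq[of "{i \<in> W. l \<in> ends s t i}"] fin e that by auto
  then show thesis using that e by blast
qed

text \<open>
  The word of a path in the forest \<open>W\<close> from \<open>l\<close>, last edge first, so that its permutation moves \<open>l\<close> to
  the end of the path.
\<close>

inductive trail :: "'a set \<Rightarrow> 'p \<Rightarrow> 'a list \<Rightarrow> 'p \<Rightarrow> bool" for W :: "'a set" and l :: 'p where
  Nil: "trail W l [] l"
| Cons: "trail W l x p \<Longrightarrow> i \<in> W \<Longrightarrow> ends s t i = {p, q} \<Longrightarrow> q \<notin> insert l (\<Union>j\<in>set x. ends s t j) \<Longrightarrow>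
    trail W l (i # x) q"

lemma trail_facts:
  assumes "trail W l x p"
  shows "set x \<subseteq> W \<and> distinct x \<and> p \<in> insert l (\<Union>j\<in>set x. ends s t j) \<and>
    card (insert l (\<Union>j\<in>set x. ends s t j)) = Suc (length x)"
  using assms
proof induction
  case Nil
  then show ?case by simp
next
  case (Cons x p i q)
  let ?V = "insert l (\<Union>j\<in>set x. ends s t j)"
  have "insert l (\<Union>j\<in>set (i # x). ends s t j) = insert q ?V"
    using Cons.IH Cons.hyps(3) by auto
  moreover have "finite ?V" by (simp add: ends_def)
  moreover have "i \<notin> set x" using Cons.hyps(3,4) by auto
  ultimately show ?case
    using Cons.IH Cons.hyps by (simp add: card_insert_disjoint)
qed

lemma trail_closed: "trail W l x l \<Longrightarrow> x = []"
  by (erule trail.cases) auto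

end

text \<open>
  In the lemmas below, the trails from \<open>l\<close> serve as coset representatives for the subgroup generated by
  \<open>W - {e}\<close> in the group generated by \<open>W\<close>.
\<close>

locale leaf = forest_model Q s t for Q :: "'a quiver" and s t :: "'a \<Rightarrow> 'p" +
  fixes W :: "'a set" and l :: 'p and e :: 'a
  assumes W: "W \<subseteq> verts Q"
    and leaf_end: "l \<in> ends s t e"
    and leaf_edge: "f \<in> W \<Longrightarrow> l \<in> ends s t f \<Longrightarrow> f = e"
begin

text \<open>
  The generator of an edge \<open>i\<close> away from the end of the trail can be moved to the right through the
  trail, where it becomes a word in \<open>W - {e}\<close>. It commutes with the letters of edges that it does not
  meet. Suppose that it meets the edge \<open>f\<close> of the trail at the point where \<open>f\<close> continues the edge \<open>g\<close>,
  and let \<open>z\<close> be the trail before \<open>g\<close>. If \<open>i = g\<close>, the braid relation turns \<open>i f i\<close> into \<open>f i f\<close>. If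
  \<open>i\<close> branches off at that point, \<open>i f g = f (f i f) g = f g (f i f)\<close> by \<open>sim_star\<close>. In both cases
  only the letters \<open>f\<close> and \<open>i\<close> remain to be moved through \<open>z\<close>, whose end they do not meet.
\<close>

lemma push_past_trail:
  assumes "trail W l x p" "i \<in> W" "p \<notin> ends s t i"
  shows "\<exists>h. set h \<subseteq> W - {e} \<and> i # x \<sim> x @ h"
  using assms
proof (induction "length x" arbitrary: x p i rule: less_induct)
  case less
  from less.prems(1) show ?case
  proof cases
    case Nil
    then have "i \<noteq> e" using less.prems(3) leaf_end by auto
    then show ?thesis
      using Nil sim_refl[of "[i]"] less.prems(2) W by (intro exI[of _ "[i]"]) auto
  next
    case (Cons y p1 f)
    note f = \<open>f \<in> W\<close> \<open>ends s t f = {p1, p}\<close>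
    have x: "x = f # y" and y: "trail W l y p1" by fact+
    have p: "p \<notin> insert l (\<Union>j\<in>set y. ends s t j)" by fact
    have yW: "set y \<subseteq> W" using trail_facts[OF y] by simp
    have V: "i \<in> verts Q" "f \<in> verts Q" "set y \<subseteq> verts Q" using less.prems(2) f(1) yW W by auto
    have "i \<noteq> f" using f less.prems(3) by auto
    show ?thesis
    proof (cases "p1 \<in> ends s t i")
      case False
      obtain h where h: "set h \<subseteq> W - {e}" "i # y \<sim> y @ h"
        using less.hyps[OF _ y less.prems(2) False] x by auto
      have "ends s t i \<inter> ends s t f = {}" using f(2) False less.prems(3) by auto
      then have "i # f # y \<sim> f # i # y"
        using sim_suffix[OF sim_commute[OF V(1,2) \<open>i \<noteq> f\<close>] V(3)] by simp
      also have "f # i # y \<sim> f # y @ h"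
        using sim_Cons[OF h(2) V(2)] .
      finally show ?thesis using h(1) x by auto
    next
      case True
      from y show ?thesis
      proof cases
        case Nil
        then have "i = e" "f = e" using leaf_edge less.prems(2) f True by auto
        then show ?thesis using \<open>i \<noteq> f\<close> by simp
      next
        case (Cons z p2 g)
        note g = \<open>g \<in> W\<close> \<open>ends s t g = {p2, p1}\<close>
        have y': "y = g # z" and z: "trail W l z p2" by fact+
        have "p1 \<notin> insert l (\<Union>j\<in>set z. ends s t j)" by fact
        then have "p1 \<noteq> p2" using trail_facts[OF z] by auto
        have pg: "p \<notin> ends s t g" using p y' by auto
        then have "f \<noteq> g" using f by auto
        have gV: "g \<in> verts Q" "set z \<subseteq> verts Q" using V y' by auto
        have "p2 \<notin> ends s t f" using f(2) \<open>p1 \<noteq> p2\<close> pg g(2) by auto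
        then obtain hf where hf: "set hf \<subseteq> W - {e}" "f # z \<sim> z @ hf"
          using less.hyps[OF _ z f(1)] x y' by auto
        have hfV: "set hf \<subseteq> verts Q" using hf W by auto
        show ?thesis
        proof (cases "i = g")
          case True
          have "i # f # i # z \<sim> f # i # f # z"
            using sim_suffix[OF sim_braid[OF V(1,2) \<open>i \<noteq> f\<close>, of p1] gV(2)] \<open>p1 \<in> ends s t i\<close> f(2) by simp
          also have "f # i # f # z \<sim> f # i # z @ hf"
            using sim_prefix[OF hf(2), of "[f, i]"] V by simp
          finally show ?thesis using hf(1) x y' True by auto
        next
          case False
          have "p2 \<notin> ends s t i"
            using at_most_one_common_end[of i g p1 p2] False V gV g(2) \<open>p1 \<in> ends s t i\<close> \<open>p1 \<noteq> p2\<close> by auto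
          then obtain hi where hi: "set hi \<subseteq> W - {e}" "i # z \<sim> z @ hi"
            using less.hyps[OF _ z less.prems(2)] x y' by auto
          have hiV: "set hi \<subseteq> verts Q" using hi W by auto
          have "i # f # g # z \<sim> f # f # i # f # g # z"
            using sim_sym[OF sim_suffix[OF sim_square[OF V(2)], of "i # f # g # z"]] V gV by simp
          also have "\<dots> \<sim> f # g # f # i # f # z"
            using sim_append[OF sim_Cons[OF sim_sym[OF sim_star[of g f i p1]], of f] sim_refl[OF gV(2)]]
              V gV \<open>i \<noteq> f\<close> \<open>f \<noteq> g\<close> False f(2) g(2) \<open>p1 \<in> ends s t i\<close> by simp
          also have "\<dots> \<sim> f # g # f # i # z @ hf"
            using sim_prefix[OF hf(2), of "[f, g, f, i]"] V gV by simp
          also have "\<dots> \<sim> f # g # f # z @ hi @ hf"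
            using sim_append[OF sim_prefix[OF hi(2), of "[f, g, f]"] sim_refl[OF hfV]] V gV by simp
          also have "\<dots> \<sim> f # g # z @ hf @ hi @ hf"
            using sim_append[OF sim_prefix[OF hf(2), of "[f, g]"] sim_refl[of "hi @ hf"]] V gV hfV hiV by simp
          finally show ?thesis
            using hf(1) hi(1) x y' by (intro exI[of _ "hf @ hi @ hf"]) auto
        qed
      qed
    qed
  qed
qed

text \<open>
  The generator of an edge at the end of the trail prolongs the trail if the other end of the edge is new. If
  not, the edge belongs to the trail, because otherwise it would close a cycle; it is then the last
  edge, and cancels.
\<close>

lemma letter_times_trail:
  assumes x: "trail W l x p" and i: "i \<in> W"
  shows "\<exists>x' h. trail W l x' (edge_swap i p) \<and> set h \<subseteq> W - {e} \<and> i # x \<sim> x' @ h"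
proof (cases "p \<in> ends s t i")
  case False
  then have "edge_swap i p = p" by (auto simp: ends_def)
  then show ?thesis using push_past_trail[OF x i False] x by auto
next
  case True
  let ?V = "insert l (\<Union>j\<in>set x. ends s t j)"
  have iV: "i \<in> verts Q" using i W by auto
  have xV: "set x \<subseteq> verts Q" using trail_facts[OF x] W by auto
  obtain q where q: "q \<noteq> p" "ends s t i = {p, q}" "edge_swap i = Transposition.transpose p q"
    using edge_swap_at[OF True iV] .
  show ?thesis
  proof (cases "q \<in> ?V")
    case False
    then have "trail W l (i # x) q"
      using trail.Cons[OF x i q(2)] by simp
    then have "trail W l (i # x) (edge_swap i p) \<and> set [] \<subseteq> W - {e} \<and> i # x \<sim> (i # x) @ []"
      using q(3) sim_refl[of "i # x"] iV xV by simp
    then show ?thesis by (intro exI)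
  next
    case qV: True
    have "i \<in> set x"
    proof (rule ccontr)
      assume "i \<notin> set x"
      have "card (s ` set (i # x) \<union> t ` set (i # x)) \<le> card ?V"
        unfolding image_Un_eq_Union_ends
        using trail_facts[OF x] q(2) qV by (intro card_mono) (auto simp: ends_def)
      also have "\<dots> = card (set (i # x))"
        using trail_facts[OF x] \<open>i \<notin> set x\<close> by (simp add: distinct_card)
      finally show False
        using forest[of "set (i # x)"] iV xV by simp
    qed
    from x show ?thesis
    proof cases
      case Nil
      then show ?thesis using \<open>i \<in> set x\<close> by simp
    next
      case (Cons y p1 f)
      have "i = f"
        using \<open>i \<in> set x\<close> Cons True by auto
      then have "edge_swap i p = p1"
        using Cons q by (auto simp: doubleton_eq_iff)
      moreover have "i # x \<sim> y"
        using sim_suffix[OF sim_square[OF iV], of y] Cons xV \<open>i = f\<close> by simp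
      ultimately have "trail W l y (edge_swap i p) \<and> set [] \<subseteq> W - {e} \<and> i # x \<sim> y @ []"
        using Cons by simp
      then show ?thesis by (intro exI)
    qed
  qed
qed

lemma coset_decomposition:
  assumes "set w \<subseteq> W"
  shows "\<exists>x h. trail W l x (word_perm w l) \<and> set h \<subseteq> W - {e} \<and> w \<sim> x @ h"
  using assms
proof (induction w)
  case Nil
  show ?case
    using trail.Nil sim_refl[of "[]"] by (intro exI[of _ "[]"]) simp
next
  case (Cons i w)
  then obtain x h where xh: "trail W l x (word_perm w l)" "set h \<subseteq> W - {e}" "w \<sim> x @ h" by auto
  from letter_times_trail[OF xh(1), of i] Cons.prems
  obtain x' h' where xh': "trail W l x' (edge_swap i (word_perm w l))" "set h' \<subseteq> W - {e}" "i # x \<sim> x' @ h'"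
    by auto
  have V: "i \<in> verts Q" "set h \<subseteq> verts Q" using Cons.prems xh(2) W by auto
  have "i # w \<sim> (i # x) @ h" using sim_Cons[OF xh(3) V(1)] by simp
  also have "\<dots> \<sim> x' @ h' @ h" using sim_suffix[OF xh'(3) V(2)] by simp
  finally have "trail W l x' (word_perm (i # w) l) \<and> set (h' @ h) \<subseteq> W - {e} \<and> i # w \<sim> x' @ h' @ h"
    using xh(2) xh'(1,2) by simp
  then show ?case by (intro exI)
qed

end

context forest_model
begin

lemma perm_id_imp_trivial:
  assumes "W \<subseteq> verts Q" "set w \<subseteq> W" "word_perm w = id"
  shows "w \<sim> []"
proof -
  have "finite W" using assms(1) finite_verts by (rule finite_subset)
  then show ?thesis using assms
  proof (induction W arbitrary: w rule: finite_psubset_induct)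
    case (psubset W)
    show ?case
    proof (cases "W = {}")
      case True
      then show ?thesis using psubset.prems sim_refl[of "[]"] by simp
    next
      case False
      obtain l e where e: "e \<in> W" "l \<in> ends s t e" "\<And>f. f \<in> W \<Longrightarrow> l \<in> ends s t f \<Longrightarrow> f = e"
        by (rule exists_leaf[OF psubset.prems(1) False]) (rule that)
      interpret leaf Q s t W l e
        by (rule leaf.intro[OF forest_model_axioms leaf_axioms.intro[OF psubset.prems(1) e(2,3)]])
      obtain x h where x: "trail W l x (word_perm w l)" and h: "set h \<subseteq> W - {e}" and "w \<sim> x @ h"
        using coset_decomposition[OF psubset.prems(2)] by blast
      moreover have "x = []"
        using x unfolding psubset.prems(3) id_apply by (rule trail_closed)
      ultimately have "w \<sim> h" by simp
      have "word_perm h = word_perm w"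
        using perm_pres_cong[of "pos_word w" "pos_word h"] \<open>w \<sim> h\<close> by (simp add: sim_def)
      then have "h \<sim> []"
        using psubset.IH[of "W - {e}" h] psubset.prems h e(1) by auto
      with \<open>w \<sim> h\<close> show ?thesis by (rule sim_trans)
    qed
  qed
qed

lemma sim_iff_perm_eq:
  assumes V: "set u \<subseteq> verts Q" "set v \<subseteq> verts Q"
  shows "u \<sim> v \<longleftrightarrow> word_perm u = word_perm v"
proof
  assume "u \<sim> v"
  then show "word_perm u = word_perm v"
    using perm_pres_cong[of "pos_word u" "pos_word v"] by (simp add: sim_def)
next
  assume eq: "word_perm u = word_perm v"
  have inv: "word_perm (rev w) \<circ> word_perm w = id" for w
    by (induction w) (auto simp: fun_eq_iff)
  have rev_trivial: "rev v @ v \<sim> []"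
    using perm_id_imp_trivial[of "verts Q" "rev v @ v"] V inv[of v] by simp
  have "u @ rev v \<sim> []"
    using perm_id_imp_trivial[of "verts Q" "u @ rev v"] V inv[of "rev v"] eq by simp
  have "u \<sim> u @ rev v @ v"
    using sim_sym[OF sim_prefix[OF rev_trivial V(1)]] by simp
  also have "\<dots> \<sim> v"
    using sim_suffix[OF \<open>u @ rev v \<sim> []\<close> V(2)] by simp
  finally show "u \<sim> v" .
qed

text \<open>
  Formal inverses may be replaced by generators, because \<open>t\<^sub>i\<^sup>2 = e\<close>.
\<close>

lemma pres_cong_pos_word:
  assumes "w \<in> gwords (verts Q)"
  shows "(w, pos_word (map fst w)) \<in> pres_cong (verts Q) (cluster_relations Q)"
  using assms
proof (induction w)
  case Nil
  then show ?case by (simp add: pres_cong.refl)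
next
  case (Cons a w)
  let ?C = "pres_cong (verts Q) (cluster_relations Q)"
  obtain i b where a: "a = (i, b)" by (cases a)
  then have i: "i \<in> verts Q" and IH: "(w, pos_word (map fst w)) \<in> ?C"
    using Cons by auto
  have "([(i, b)], [(i, True)]) \<in> ?C"
  proof (cases b)
    case True
    then show ?thesis using i by (simp add: pres_cong.refl)
  next
    case False
    have "([(i, False)] @ pos_word [i, i], [(i, False)] @ []) \<in> ?C"
      using sim_square[OF i] i by (intro pres_cong_append) (simp_all add: sim_def pres_cong.refl)
    moreover have "([] @ [(i, False), (i, \<not> False)] @ [(i, True)], [] @ [(i, True)]) \<in> ?C"
      using i by (intro pres_cong.cancel) simp_all
    ultimately show ?thesis
      using False pres_cong.sym pres_cong.trans by (simp add: pos_word_def) blast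
  qed
  from pres_cong_append[OF this IH] show ?case by (simp add: a pos_word_def)
qed

lemma pres_cong_iff_word_perm_eq:
  assumes "u \<in> gwords (verts Q)" "v \<in> gwords (verts Q)"
  shows "(u, v) \<in> pres_cong (verts Q) (cluster_relations Q) \<longleftrightarrow> word_perm (map fst u) = word_perm (map fst v)"
proof
  assume "(u, v) \<in> pres_cong (verts Q) (cluster_relations Q)"
  then show "word_perm (map fst u) = word_perm (map fst v)" by (rule perm_pres_cong)
next
  assume "word_perm (map fst u) = word_perm (map fst v)"
  moreover have "set (map fst u) \<subseteq> verts Q" "set (map fst v) \<subseteq> verts Q"
    using assms by (auto simp: gwords_def)
  ultimately have "map fst u \<sim> map fst v" by (simp add: sim_iff_perm_eq)
  then show "(u, v) \<in> pres_cong (verts Q) (cluster_relations Q)"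
    unfolding sim_def
    using pres_cong_pos_word[OF assms(1)] pres_cong_pos_word[OF assms(2)]
    by (blast intro: pres_cong.sym pres_cong.trans)
qed

end

section \<open>The subgroup generated by a subset of the generators\<close>

text \<open>
  The map enlarges a congruence class of words over \<open>I\<close> to a class of words over \<open>S\<close>. The two directions
  of \<open>same\<close> give that it is well defined and that it is injective.
\<close>

lemma subpresentation_iso:
  assumes IS: "I \<subseteq> S"
    and same: "\<And>u v. u \<in> gwords I \<Longrightarrow> v \<in> gwords I \<Longrightarrow> (u, v) \<in> pres_cong I R' \<longleftrightarrow> (u, v) \<in> pres_cong S R"
  shows "\<exists>\<phi>. \<phi> \<in> iso (presented_group I R') (subgroup_generated (presented_group S R) (pres_gen S R ` I)) \<and>
    (\<forall>i\<in>I. \<phi> (pres_gen I R' i) = pres_gen S R i)"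
proof -
  let ?G = "presented_group S R" and ?c = "\<lambda>w. pres_cong S R `` {w}" and ?d = "\<lambda>w. pres_cong I R' `` {w}"
  define \<phi> where "\<phi> A = pres_cong S R `` A" for A
  interpret G: group ?G by (rule group_presented_group)
  have sub: "w \<in> gwords S" if "w \<in> gwords I" for w
    using that IS by (auto simp: gwords_def)
  have \<phi>: "\<phi> (?d u) = ?c u" if u: "u \<in> gwords I" for u
  proof
    show "\<phi> (?d u) \<subseteq> ?c u"
    proof
      fix w assume "w \<in> \<phi> (?d u)"
      then obtain v where v: "(u, v) \<in> pres_cong I R'" "(v, w) \<in> pres_cong S R"
        by (auto simp: \<phi>_def)
      then have "(u, v) \<in> pres_cong S R"
        using same pres_cong_gwords by blast
      then show "w \<in> ?c u" using v(2) by (auto intro: pres_cong.trans)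
    qed
    show "?c u \<subseteq> \<phi> (?d u)"
      using pres_cong.refl[OF u] by (auto simp: \<phi>_def)
  qed
  have carrier_d: "carrier (presented_group I R') = ?d ` gwords I"
    by (auto simp: presented_group_def quotient_def)
  have c_in: "?c w \<in> carrier ?G" if "w \<in> gwords S" for w
    using that by (auto simp: presented_group_def quotient_def)
  have gens: "pres_gen S R ` I \<subseteq> carrier ?G"
    using IS by (auto simp: pres_gen_def intro!: c_in)
  have one: "\<one>\<^bsub>?G\<^esub> = ?c []" by (simp add: presented_group_def)
  have inv: "inv\<^bsub>?G\<^esub> (?c [(i, True)]) = ?c [(i, False)]" if "i \<in> I" for i
  proof (rule G.inv_equality)
    have "([] @ [(i, False), (i, \<not> False)] @ [], [] @ []) \<in> pres_cong S R"
      using that IS by (intro pres_cong.cancel) auto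
    then have "?c [(i, False), (i, True)] = ?c []"
      using equiv_class_eq[OF equiv_pres_cong] by fastforce
    then show "?c [(i, False)] \<otimes>\<^bsub>?G\<^esub> ?c [(i, True)] = \<one>\<^bsub>?G\<^esub>"
      using that IS by (subst presented_group_mult) (auto simp: one)
  qed (use that IS in \<open>auto intro!: c_in\<close>)
  have carrier_c: "carrier (subgroup_generated ?G (pres_gen S R ` I)) = ?c ` gwords I"
  proof -
    have "generate ?G (pres_gen S R ` I) = ?c ` gwords I"
    proof
      show "generate ?G (pres_gen S R ` I) \<subseteq> ?c ` gwords I"
      proof
        fix a assume "a \<in> generate ?G (pres_gen S R ` I)"
        then show "a \<in> ?c ` gwords I"
        proof induction
          case one
          show ?case using \<open>\<one>\<^bsub>?G\<^esub> = ?c []\<close> by auto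
        next
          case (incl h)
          then show ?case by (auto simp: pres_gen_def)
        next
          case (inv h)
          then show ?case using \<open>\<And>i. i \<in> I \<Longrightarrow> inv\<^bsub>?G\<^esub> (?c [(i, True)]) = ?c [(i, False)]\<close>
            by (auto simp: pres_gen_def)
        next
          case (eng h1 h2)
          then obtain u v where "u \<in> gwords I" "v \<in> gwords I" "h1 = ?c u" "h2 = ?c v" by blast
          then show ?case using sub by (auto simp: presented_group_mult)
        qed
      qed
      show "?c ` gwords I \<subseteq> generate ?G (pres_gen S R ` I)"
      proof safe
        fix w assume "w \<in> gwords I"
        then show "?c w \<in> generate ?G (pres_gen S R ` I)"
        proof (induction w)
          case Nil
          then show ?case using generate.one[of ?G] by (simp add: one)
        next
          case (Cons a w)
          obtain i b where a: "a = (i, b)" by (cases a)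
          then have i: "i \<in> I" and w: "w \<in> gwords I" using Cons.prems by auto
          have "?c [(i, True)] \<in> pres_gen S R ` I"
            using i by (simp add: pres_gen_def)
          then have "?c [(i, b)] \<in> generate ?G (pres_gen S R ` I)"
            using generate.incl[of _ "pres_gen S R ` I" ?G] generate.inv[of _ "pres_gen S R ` I" ?G] inv[OF i]
            by (cases b) metis+
          moreover have "?c (a # w) = ?c [(i, b)] \<otimes>\<^bsub>?G\<^esub> ?c w"
            using i w sub IS by (subst presented_group_mult) (auto simp: a)
          ultimately show ?case
            using Cons.IH[OF w] by (simp add: generate.eng)
        qed
      qed
    qed
    then show ?thesis
      using gens by (simp add: carrier_subgroup_generated inf_absorb2)
  qed
  have "\<phi> \<in> hom (presented_group I R') (subgroup_generated ?G (pres_gen S R ` I))"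
  proof (rule homI)
    fix a assume "a \<in> carrier (presented_group I R')"
    then show "\<phi> a \<in> carrier (subgroup_generated ?G (pres_gen S R ` I))"
      unfolding carrier_c carrier_d using \<phi> by auto
  next
    fix a b assume "a \<in> carrier (presented_group I R')" "b \<in> carrier (presented_group I R')"
    then obtain u v where "u \<in> gwords I" "v \<in> gwords I" "a = ?d u" "b = ?d v"
      unfolding carrier_d by blast
    then show "\<phi> (a \<otimes>\<^bsub>presented_group I R'\<^esub> b)
      = \<phi> a \<otimes>\<^bsub>subgroup_generated ?G (pres_gen S R ` I)\<^esub> \<phi> b"
      using sub by (simp add: presented_group_mult \<phi>)
  qed
  moreover have "inj_on \<phi> (carrier (presented_group I R'))"
  proof (rule inj_onI)
    fix a b assume "a \<in> carrier (presented_group I R')" "b \<in> carrier (presented_group I R')" "\<phi> a = \<phi> b"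
    then obtain u v where uv: "u \<in> gwords I" "v \<in> gwords I" "a = ?d u" "b = ?d v"
      unfolding carrier_d by blast
    then have "?c u = ?c v" using \<open>\<phi> a = \<phi> b\<close> \<phi> by simp
    then have "(u, v) \<in> pres_cong S R"
      using eq_equiv_class[OF _ equiv_pres_cong] sub[OF uv(2)] by blast
    then have "(u, v) \<in> pres_cong I R'" using same uv by blast
    then show "a = b" using uv equiv_class_eq[OF equiv_pres_cong] by blast
  qed
  moreover have "\<phi> ` carrier (presented_group I R') = carrier (subgroup_generated ?G (pres_gen S R ` I))"
    unfolding carrier_c carrier_d using \<phi> by (auto simp: image_image)
  moreover have "\<phi> (pres_gen I R' i) = pres_gen S R i" if "i \<in> I" for i
    using \<phi>[of "[(i, True)]"] that by (simp add: pres_gen_def)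
  ultimately show ?thesis
    by (intro exI[of _ \<phi>]) (auto simp: iso_def bij_betw_def)
qed

theorem theorem5p2:
  fixes Q :: "'a quiver"
    and r :: nat
    and comp :: "nat \<Rightarrow> 'a quiver"
    and n :: "nat \<Rightarrow> nat"
    and I :: "'a set"
  assumes "cluster_quiver Q"
    and "bij_betw comp {1..r} (connected_components Q)"
    and "\<And>k. k \<in> {1..r} \<Longrightarrow> n k \<ge> 1"
    and "\<And>k. k \<in> {1..r} \<Longrightarrow> mutation_dynkin_A (n k) (comp k)"
    and "I \<subseteq> verts Q"
  shows "\<exists>\<phi>. \<phi> \<in> iso (cluster_group (full_subquiver Q I))
                     (subgroup_generated (cluster_group Q) (cluster_gen Q ` I)) \<and>
             (\<forall>i\<in>I. \<phi> (cluster_gen (full_subquiver Q I) i) = cluster_gen Q i)"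
proof -
  have "\<exists>s t :: 'a \<Rightarrow> nat. forest_model C s t" if C: "C \<in> connected_components Q" for C
  proof -
    obtain k where "k \<in> {1..r}" "C = comp k"
      using C bij_betw_imp_surj_on[OF assms(2)] by blast
    then show ?thesis using forest_model_mutation_dynkin_A assms(4) by blast
  qed
  then have "\<exists>s t :: 'a \<Rightarrow> 'a set \<times> nat. forest_model Q s t"
    using forest_model_glue[OF assms(1)] by blast
  then obtain s t :: "'a \<Rightarrow> 'a set \<times> nat" where Q: "forest_model Q s t"
    by (elim exE)
  interpret Q: forest_model Q s t by (fact Q)
  interpret QI: forest_model "full_subquiver Q I" s t
    using assms(5) by (rule Q.forest_model_full_subquiver)
  have verts_I: "verts (full_subquiver Q I) = I"
    by (simp add: full_subquiver_def)
  have "(u, v) \<in> pres_cong I (cluster_relations (full_subquiver Q I)) \<longleftrightarrow>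
      (u, v) \<in> pres_cong (verts Q) (cluster_relations Q)"
    if uv: "u \<in> gwords I" "v \<in> gwords I" for u v
  proof -
    have "u \<in> gwords (verts Q)" "v \<in> gwords (verts Q)"
      using uv assms(5) by (auto simp: gwords_def)
    then show ?thesis
      using QI.pres_cong_iff_word_perm_eq[of u v] Q.pres_cong_iff_word_perm_eq[of u v] uv by (simp add: verts_I)
  qed
  from subpresentation_iso[OF assms(5) this] show ?thesis
    by (simp add: cluster_group_def cluster_gen_def[abs_def] verts_I)
qed

end
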